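(* Let $(\Theta_k)_{k\ge 0}$ be the iterates in $\mathbb{R}^{m\times n}$, $m\le n$, generated by the NG+ method (described in the context) for $\min_{\Theta}\Psi(\Theta)$, with step sizes $\alpha_k>0$, damping values $\lambda_k$, curvature matrices $L_k$ and mini-batch gradients $G_k$, so that $\Theta_{k+1}=\Theta_k-\alpha_k(\lambda_k I+L_k)^{-1}G_k$. Suppose that: (1) $\Psi$ is continuously differentiable on $\mathbb{R}^{m\times n}$ and bounded below, i.e. $\Psi(\Theta)\ge\Psi^*$ for all $\Theta$, and $\nabla\Psi$ is $L_\Psi$-Lipschitz continuous: $\|\nabla\Psi(\Theta_1)-\nabla\Psi(\Theta_2)\|_F\le L_\Psi\|\Theta_1-\Theta_2\|_F$ for all $\Theta_1,\Theta_2\in\mathbb{R}^{m\times n}$; (2) there exist positive constants $h_1,h_2$ such that $h_1 I\preceq L_k+\lambda_k I\preceq h_2 I$ for all $k$; (3) for all $k$, almost surely, $\mathbb{E}[G_k\mid\Theta_k,\dots,\Theta_0]=\nabla\Psi(\Theta_k)$ and $\mathbb{E}[\|G_k-\nabla\Psi(\Theta_k)\|_F^2\mid\Theta_k,\dots,\Theta_0]\le\sigma_k^2$. Suppose moreover that the step sizes satisfy $\alpha_k\le\frac{2h_1^2}{L_\Psi h_2}$ for all $k$, $\sum_k\alpha_k=\infty$ and $\sum_k\alpha_k^2\sigma_k^2<\infty$. Then, with probability 1, $$\lim_{k\to\infty}\|\nabla\Psi(\Theta_k)\|_F=0.$$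
   Context: The objective is $\Psi(\Theta)=\frac1N\sum_{i=1}^N\psi_i(\Theta)$, $\Theta\in\mathbb{R}^{m\times n}$, where $\psi_i(\Theta)=\psi(x_i,y_i,\Theta)$ is the loss on the $i$-th data point. Write $\mathcal{G}_{i,k}=\nabla\psi_i(\Theta_k)\in\mathbb{R}^{m\times n}$. It is assumed that $m\le n$ and that the update frequency $\mathcal{T}$ is a constant positive integer. NG+ method (case $m\le n$): given an initial $\Theta_0$, at each iteration $k=0,1,\dots$ choose a sample set $B_k$ and form the mini-batch gradient $G_k=\frac{1}{|B_k|}\sum_{i\in B_k}\mathcal{G}_{i,k}$. If $k \bmod \mathcal{T}=0$, choose a sample set $S_k$ and set $L_k=\frac{1}{|S_k|}\sum_{i\in S_k}\mathcal{G}_{i,k}\mathcal{G}_{i,k}^\top\in\mathbb{R}^{m\times m}$; otherwise set $L_k=L_{k-1}$. Then compute $D_k=-(\lambda_k I+L_k)^{-1}G_k$, where $\lambda_k$ is a damping value, and set $\Theta_{k+1}=\Theta_k+\alpha_kD_k$. $\|\cdot\|_F$ is the Frobenius norm and $A\preceq B$ means that $B-A$ is positive semidefinite.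
   Formalization: The formal theorem additionally assumes h_1 < h_2 and that, given Θ_0,…,Θ_k, the matrix λ_k I + L_k and the mini-batch gradient G_k are conditionally independent; without either assumption the statement as printed is false. *)

theory Defs
  imports "HOL-Probability.Probability"
begin

text \<open>Matrices with \<open>m\<close> rows and \<open>n\<close> columns are elements of \<open>real ^ 'n ^ 'm\<close>. The library's
  inner product and norm on this type are the Frobenius inner product and the Frobenius norm.\<close>

text \<open>Meaningful only at points where \<open>f\<close> is differentiable; the gradient is then unique.\<close>

definition grad :: "('a::euclidean_space \<Rightarrow> real) \<Rightarrow> 'a \<Rightarrow> 'a" where
  "grad f x = (THE D. GDERIV f x :> D)"

definition psd :: "real ^ 'm ^ 'm \<Rightarrow> bool" where
  "psd A \<longleftrightarrow> transpose A = A \<and> (\<forall>v. 0 \<le> v \<bullet> (A *v v))"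

definition loewner_le :: "real ^ 'm ^ 'm \<Rightarrow> real ^ 'm ^ 'm \<Rightarrow> bool"  (infix \<open>\<preceq>\<^sub>L\<close> 50) where
  "A \<preceq>\<^sub>L B \<longleftrightarrow> psd (B - A)"

text \<open>In the following, \<open>psi i\<close> is the loss on the \<open>i\<close>-th of \<open>N\<close> data points, \<open>i \<in> {1..N}\<close>.\<close>

definition objective :: "nat \<Rightarrow> (nat \<Rightarrow> real ^ 'n ^ 'm \<Rightarrow> real) \<Rightarrow> real ^ 'n ^ 'm \<Rightarrow> real" where
  "objective N psi \<Theta> = (1 / real N) * (\<Sum>i = 1..N. psi i \<Theta>)"

definition minibatch_grad ::
    "(nat \<Rightarrow> real ^ 'n ^ 'm \<Rightarrow> real) \<Rightarrow> nat set \<Rightarrow> real ^ 'n ^ 'm \<Rightarrow> real ^ 'n ^ 'm" where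
  "minibatch_grad psi B \<Theta> = (1 / real (card B)) *\<^sub>R (\<Sum>i\<in>B. grad (psi i) \<Theta>)"

definition curvature ::
    "(nat \<Rightarrow> real ^ 'n ^ 'm \<Rightarrow> real) \<Rightarrow> nat set \<Rightarrow> real ^ 'n ^ 'm \<Rightarrow> real ^ 'm ^ 'm" where
  "curvature psi S \<Theta> =
     (1 / real (card S)) *\<^sub>R (\<Sum>i\<in>S. grad (psi i) \<Theta> ** transpose (grad (psi i) \<Theta>))"

definition damped :: "real \<Rightarrow> real ^ 'm ^ 'm \<Rightarrow> real ^ 'm ^ 'm" where
  "damped l L = l *\<^sub>R mat 1 + L"

text \<open>One sample path of the method with update period \<open>T\<close>, starting point \<open>\<Theta>0\<close>, step sizes \<open>\<alpha>\<close>,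
  damping values \<open>l\<close> and sample sets \<open>B\<close>, \<open>S\<close>; \<open>G\<close>, \<open>L\<close>, \<open>\<Theta>\<close> are the mini-batch gradients,
  curvature matrices and iterates it produces. For \<open>k = 0\<close> the first branch of the conditional
  applies, so \<open>L (k - 1)\<close> is never read at \<open>k = 0\<close>.\<close>

definition ng_plus ::
    "(nat \<Rightarrow> real ^ 'n ^ 'm \<Rightarrow> real) \<Rightarrow> nat \<Rightarrow> real ^ 'n ^ 'm \<Rightarrow> (nat \<Rightarrow> real) \<Rightarrow> (nat \<Rightarrow> real) \<Rightarrow>
     (nat \<Rightarrow> nat set) \<Rightarrow> (nat \<Rightarrow> nat set) \<Rightarrow>
     (nat \<Rightarrow> real ^ 'n ^ 'm) \<Rightarrow> (nat \<Rightarrow> real ^ 'm ^ 'm) \<Rightarrow> (nat \<Rightarrow> real ^ 'n ^ 'm) \<Rightarrow> bool" where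
  "ng_plus psi T \<Theta>0 \<alpha> l B S G L \<Theta> \<longleftrightarrow>
     \<Theta> 0 = \<Theta>0 \<and>
     (\<forall>k. G k = minibatch_grad psi (B k) (\<Theta> k)) \<and>
     (\<forall>k. L k = (if k mod T = 0 then curvature psi (S k) (\<Theta> k) else L (k - 1))) \<and>
     (\<forall>k. \<Theta> (Suc k) = \<Theta> k + \<alpha> k *\<^sub>R (- (matrix_inv (damped (l k) (L k)) ** G k)))"

text \<open>The sigma-algebra on \<open>space M\<close> generated by \<open>X 0, \<dots>, X k\<close>.\<close>

definition history :: "'w measure \<Rightarrow> (nat \<Rightarrow> 'w \<Rightarrow> 'a::topological_space) \<Rightarrow> nat \<Rightarrow> 'w measure" where
  "history M X k = sigma (space M) (\<Union>j\<in>{..k}. {X j -` A \<inter> space M | A. A \<in> sets borel})"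

text \<open>Entrywise, since the library's conditional expectation is real-valued.\<close>

definition mat_cond_exp ::
    "'w measure \<Rightarrow> 'w measure \<Rightarrow> ('w \<Rightarrow> real ^ 'n ^ 'm) \<Rightarrow> 'w \<Rightarrow> real ^ 'n ^ 'm" where
  "mat_cond_exp M F X \<omega> = (\<chi> i j. real_cond_exp M F (\<lambda>\<omega>'. X \<omega>' $ i $ j) \<omega>)"

definition cond_indep_var ::
    "'w measure \<Rightarrow> 'w measure \<Rightarrow> ('w \<Rightarrow> 'a::topological_space) \<Rightarrow> ('w \<Rightarrow> 'b::topological_space) \<Rightarrow> bool"
  where
  "cond_indep_var M F X Y \<longleftrightarrow>
     (\<forall>A\<in>sets borel. \<forall>C\<in>sets borel. AE \<omega> in M.
        real_cond_exp M F (\<lambda>\<omega>'. indicator A (X \<omega>') * indicator C (Y \<omega>')) \<omega> =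
        real_cond_exp M F (\<lambda>\<omega>'. indicator A (X \<omega>')) \<omega> *
        real_cond_exp M F (\<lambda>\<omega>'. indicator C (Y \<omega>')) \<omega>)"

end

theory Submission
  imports Defs
begin

text \<open>Write \<open>P\<^sub>k\<close> for the inverse of the damped curvature matrix and \<open>X\<^sub>k\<close> for the noise \<open>G\<^sub>k - \<nabla>\<Psi>(\<Theta>\<^sub>k)\<close>.
  Conditional independence makes \<open>\<phi>(P\<^sub>k) X\<^sub>k\<close> orthogonal to every square integrable function of the
  past iterates, so the descent inequality for gradients that are Lipschitz continuous gives
  \<open>E \<Psi>(\<Theta>\<^sub>k\<^sub>+\<^sub>1) \<le> E \<Psi>(\<Theta>\<^sub>k) - \<rho> \<alpha>\<^sub>k E |\<nabla>\<Psi>(\<Theta>\<^sub>k)|\<^sup>2 + c \<alpha>\<^sub>k\<^sup>2 \<sigma>\<^sub>k\<^sup>2\<close> with \<open>\<rho> > 0\<close>, because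
  \<open>L\<^sub>\<Psi> \<alpha>\<^sub>k / (2 h\<^sub>1) \<le> h\<^sub>1 / h\<^sub>2 < 1\<close>. Hence \<open>\<Sum> \<alpha>\<^sub>k |\<nabla>\<Psi>(\<Theta>\<^sub>k)|\<^sup>2\<close> is almost surely finite and the
  lower limit of \<open>|\<nabla>\<Psi>(\<Theta>\<^sub>k)|\<close> is zero.

  For the full limit, split \<open>\<Theta>\<^sub>k\<^sub>+\<^sub>1 - \<Theta>\<^sub>k\<close> into its conditional mean given the past iterates, of size
  \<open>O(\<alpha>\<^sub>k |\<nabla>\<Psi>(\<Theta>\<^sub>k)|)\<close>, and a martingale difference. (The noise \<open>P\<^sub>k X\<^sub>k\<close> itself is not adapted to the
  filtration of the iterates, since \<open>P\<^sub>k\<close> need not be a function of them.) The martingale differences have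
  summable second moments, so their series converges almost surely, and then \<open>\<Theta>\<close> moves too little
  for \<open>|\<nabla>\<Psi>|\<close> to climb from \<open>\<epsilon>\<close> to \<open>2 \<epsilon>\<close> infinitely often.\<close>


section \<open>Deterministic estimates\<close>

text \<open>If \<open>g n \<ge> 2 * \<epsilon>\<close> at some \<open>n\<close> after a late index
  where \<open>g < \<epsilon>\<close>, let \<open>p\<close> be the last index before
  \<open>n\<close> with \<open>g p < \<epsilon>\<close>. Beyond \<open>p\<close> one has
  \<open>\<alpha> k * g k \<le> \<alpha> k * (g k)\<^sup>2 / \<epsilon>\<close>, so the drift is
  controlled by the tail of a convergent series, \<open>x\<close> moves by less than
  \<open>\<epsilon> / L\<close>, and the Lipschitz bound forbids the climb. The series of
  \<open>e\<close> need not converge absolutely, hence \<open>e\<close> is summed over the whole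
  stretch before its norm is taken.\<close>

lemma gradient_limit_zero:
  fixes x d e :: "nat \<Rightarrow> 'a::euclidean_space" and g \<alpha> :: "nat \<Rightarrow> real"
  assumes lip: "\<And>i j. g i - g j \<le> L * norm (x i - x j)" and L: "0 < L"
    and g0: "\<And>k. 0 \<le> g k"
    and step: "\<And>k. x (Suc k) = x k + (d k + e k)"
    and d: "\<And>k. norm (d k) \<le> C * (\<alpha> k * g k)" and C: "0 < C"
    and e: "summable e"
    and s: "summable (\<lambda>k. \<alpha> k * (g k)\<^sup>2)"
    and \<alpha>0: "\<And>k. 0 \<le> \<alpha> k" and \<alpha>A: "\<And>k. \<alpha> k \<le> A"
    and div: "\<not> summable \<alpha>"
  shows "g \<longlonglongrightarrow> 0"
proof (rule LIMSEQ_I)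
  fix r :: real assume r: "0 < r"
  define \<epsilon> where "\<epsilon> = r / 2"
  have \<epsilon>: "0 < \<epsilon>" using r by (simp add: \<epsilon>_def)
  \<comment> \<open>The climb is refuted by a move below
    \<open>4 * \<delta> = \<epsilon> / L\<close>: one \<open>\<delta>\<close> each pays for the
    single step at \<open>p\<close>, for the later drift and for the sum of \<open>e\<close>; the
    fourth is spare.\<close>
  define \<delta> where "\<delta> = \<epsilon> / (4 * L)"
  have \<delta>: "0 < \<delta>" using \<epsilon> L by (simp add: \<delta>_def)
  have A: "0 \<le> A" using \<alpha>0[of 0] \<alpha>A[of 0] by linarith
  obtain K1 where K1: "\<And>m n. m \<ge> K1 \<Longrightarrow> norm (sum e {m..<n}) < \<delta>"
    using e \<delta> unfolding summable_Cauchy by blast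
  have "0 < \<epsilon> * \<delta> / C" using \<epsilon> \<delta> C by simp
  then obtain K2 where K2: "\<And>m n. m \<ge> K2 \<Longrightarrow> norm (\<Sum>k=m..<n. \<alpha> k * (g k)\<^sup>2) < \<epsilon> * \<delta> / C"
    using s unfolding summable_Cauchy by blast
  have "(\<lambda>k. A * (\<alpha> k * (g k)\<^sup>2)) \<longlonglongrightarrow> A * 0"
    by (intro tendsto_mult tendsto_const summable_LIMSEQ_zero s)
  then have lim: "(\<lambda>k. A * (\<alpha> k * (g k)\<^sup>2)) \<longlonglongrightarrow> 0" by simp
  have "0 < (\<delta> / C)\<^sup>2" using \<delta> C by simp
  then have "\<forall>\<^sub>F k in sequentially. A * (\<alpha> k * (g k)\<^sup>2) < (\<delta> / C)\<^sup>2"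
    using order_tendstoD(2)[OF lim] by blast
  then obtain K3 where K3: "\<And>k. k \<ge> K3 \<Longrightarrow> A * (\<alpha> k * (g k)\<^sup>2) < (\<delta> / C)\<^sup>2"
    unfolding eventually_sequentially by blast
  \<comment> \<open>Needed for the step leaving \<open>p\<close>: there
    \<open>g p < \<epsilon>\<close>, so the bound that divides by \<open>\<epsilon>\<close> fails
    and boundedness of \<open>\<alpha>\<close> has to serve instead.\<close>
  have small: "\<alpha> k * g k < \<delta> / C" if "k \<ge> K3" for k
  proof -
    have "(\<alpha> k * g k)\<^sup>2 = \<alpha> k * (\<alpha> k * (g k)\<^sup>2)" by (simp add: power2_eq_square)
    also have "\<dots> \<le> A * (\<alpha> k * (g k)\<^sup>2)"
      by (intro mult_right_mono \<alpha>A mult_nonneg_nonneg \<alpha>0) simp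
    also have "\<dots> < (\<delta> / C)\<^sup>2" using K3[OF that] .
    finally show ?thesis using \<delta> C by (meson divide_nonneg_nonneg less_imp_le power2_less_imp_less)
  qed
  define K where "K = max K1 (max K2 K3)"
  \<comment> \<open>Otherwise \<open>\<alpha> k\<close> would eventually be dominated by
    \<open>\<alpha> k * (g k)\<^sup>2 / \<epsilon>\<^sup>2\<close>, against the divergence of its
    series.\<close>
  have "\<exists>m\<ge>K. g m < \<epsilon>"
  proof (rule ccontr)
    assume "\<not> (\<exists>m\<ge>K. g m < \<epsilon>)"
    then have ge: "\<epsilon> \<le> g k" if "k \<ge> K" for k using that by force
    have "summable (\<lambda>k. (\<alpha> k * (g k)\<^sup>2) / \<epsilon>\<^sup>2)" by (intro summable_divide s)
    then have "summable \<alpha>"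
    proof (rule summable_comparison_test[rotated], intro exI allI impI)
      fix k assume "K \<le> k"
      then have "\<epsilon>\<^sup>2 \<le> (g k)\<^sup>2" using ge \<epsilon> by (intro power_mono) auto
      then have "\<alpha> k * \<epsilon>\<^sup>2 \<le> \<alpha> k * (g k)\<^sup>2" by (intro mult_left_mono \<alpha>0)
      then show "norm (\<alpha> k) \<le> \<alpha> k * (g k)\<^sup>2 / \<epsilon>\<^sup>2"
        using \<epsilon> \<alpha>0[of k] by (simp add: field_simps)
    qed
    then show False using div by simp
  qed
  then obtain m where m: "m \<ge> K" "g m < \<epsilon>" by blast
  have "g n < r" if n: "n \<ge> m" for n
  proof (rule ccontr)
    assume "\<not> g n < r"
    then have gn: "2 * \<epsilon> \<le> g n" by (simp add: \<epsilon>_def)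
    define p where "p = (GREATEST p. p \<le> n \<and> g p < \<epsilon>)"
    have p: "p \<le> n \<and> g p < \<epsilon>" unfolding p_def
      by (rule GreatestI_nat[where b = n and k = m]) (use m n in auto)
    have pmax: "q \<le> p" if "q \<le> n" "g q < \<epsilon>" for q unfolding p_def
      by (rule Greatest_le_nat[where b = n]) (use that in auto)
    have "m \<le> p" using pmax[of m] m n by simp
    then have pK: "p \<ge> K" using m by simp
    have pn: "p < n" using p gn \<epsilon> by (cases "p = n") auto
    have tele: "x q - x p = (\<Sum>k=p..<q. d k + e k)" if "p \<le> q" for q
      using that by (induction q rule: dec_induct) (simp_all add: step)
    have up: "\<alpha> k * g k \<le> (\<alpha> k * (g k)\<^sup>2) / \<epsilon>" if "k \<in> {Suc p..<n}" for k
    proof -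
      have "\<epsilon> \<le> g k" using that pmax[of k] by force
      then have "(\<alpha> k * g k) * \<epsilon> \<le> (\<alpha> k * g k) * g k" by (intro mult_left_mono mult_nonneg_nonneg \<alpha>0 g0)
      then show ?thesis using \<epsilon> by (simp add: field_simps power2_eq_square)
    qed
    have "norm (\<Sum>k=p..<n. d k) \<le> (\<Sum>k=p..<n. C * (\<alpha> k * g k))"
      by (intro sum_norm_le d)
    also have "\<dots> = C * (\<alpha> p * g p) + C * (\<Sum>k=Suc p..<n. \<alpha> k * g k)"
      using pn by (simp add: sum.atLeast_Suc_lessThan sum_distrib_left)
    also have "\<dots> \<le> \<delta> + C * (\<Sum>k=Suc p..<n. (\<alpha> k * (g k)\<^sup>2) / \<epsilon>)"
    proof (intro add_mono mult_left_mono sum_mono up)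
      show "C * (\<alpha> p * g p) \<le> \<delta>" using small[of p] pK C by (simp add: K_def field_simps)
    qed (use C in auto)
    also have "\<dots> = \<delta> + C / \<epsilon> * (\<Sum>k=Suc p..<n. (\<alpha> k * (g k)\<^sup>2))"
      by (simp flip: sum_divide_distrib)
    also have "\<dots> \<le> \<delta> + C / \<epsilon> * (\<epsilon> * \<delta> / C)"
      using K2[of "Suc p" n] pK C \<epsilon> by (intro add_left_mono mult_left_mono) (auto simp: K_def)
    also have "\<dots> = 2 * \<delta>" using C \<epsilon> by (simp add: field_simps)
    finally have nd: "norm (\<Sum>k=p..<n. d k) \<le> 2 * \<delta>" .
    have "norm (x n - x p) \<le> norm (\<Sum>k=p..<n. d k) + norm (\<Sum>k=p..<n. e k)"
      using tele[of n] pn by (simp add: sum.distrib norm_triangle_ineq)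
    also have "\<dots> < 4 * \<delta>" using nd K1[of p n] pK \<delta> by (simp add: K_def)
    finally have "L * norm (x n - x p) < \<epsilon>" using L by (simp add: \<delta>_def field_simps)
    then show False using lip[of n p] gn p by linarith
  qed
  then show "\<exists>no. \<forall>n\<ge>no. norm (g n - 0) < r" using g0 by force
qed

text \<open>Along the segment from \<open>x\<close> to \<open>x + v\<close>, the excess of
  \<open>f\<close> over the quadratic model is nonincreasing: by Cauchy-Schwarz and the Lipschitz
  bound its derivative at \<open>t\<close> is at most 0. No integration is involved.\<close>

lemma lipschitz_gradient_descent:
  fixes f :: "'a::real_inner \<Rightarrow> real"
  assumes der: "\<And>x. GDERIV f x :> D x"
    and lip: "\<And>x y. norm (D x - D y) \<le> L * norm (x - y)"
  shows "f (x + v) \<le> f x + D x \<bullet> v + L / 2 * (norm v)\<^sup>2"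
proof -
  define h where "h t = f (x + t *\<^sub>R v) - t * (D x \<bullet> v) - L / 2 * t\<^sup>2 * (norm v)\<^sup>2" for t :: real
  have hd: "DERIV h t :> (D (x + t *\<^sub>R v) \<bullet> v - D x \<bullet> v - L * t * (norm v)\<^sup>2)" for t
  proof -
    have "((\<lambda>t. f (x + t *\<^sub>R v)) has_derivative (\<lambda>s. (s *\<^sub>R v) \<bullet> D (x + t *\<^sub>R v))) (at t)"
    proof (rule has_derivative_compose[of "\<lambda>t. x + t *\<^sub>R v" "\<lambda>s. s *\<^sub>R v" t UNIV f, simplified])
      show "((\<lambda>t. x + t *\<^sub>R v) has_derivative (\<lambda>s. s *\<^sub>R v)) (at t)"
        by (auto intro!: derivative_eq_intros)
      show "(f has_derivative (\<lambda>h. h \<bullet> D (x + t *\<^sub>R v))) (at (x + t *\<^sub>R v))"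
        using der[of "x + t *\<^sub>R v"] by (simp add: gderiv_def)
    qed
    then have "DERIV (\<lambda>t. f (x + t *\<^sub>R v)) t :> D (x + t *\<^sub>R v) \<bullet> v"
      by (simp add: has_field_derivative_def inner_commute mult_commute_abs)
    then show ?thesis unfolding h_def
      by (auto intro!: derivative_eq_intros)
  qed
  have "h 1 \<le> h 0"
  proof (rule DERIV_nonpos_imp_nonincreasing[of 0 1 h])
    fix t :: real assume t: "0 \<le> t" "t \<le> 1"
    have "D (x + t *\<^sub>R v) \<bullet> v - D x \<bullet> v = (D (x + t *\<^sub>R v) - D x) \<bullet> v" by (simp add: inner_diff_left)
    also have "\<dots> \<le> norm (D (x + t *\<^sub>R v) - D x) * norm v" by (rule norm_cauchy_schwarz)
    also have "\<dots> \<le> (L * norm ((x + t *\<^sub>R v) - x)) * norm v" by (intro mult_right_mono lip) simp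
    also have "\<dots> = L * t * (norm v)\<^sup>2" using t by (simp add: power2_eq_square)
    finally show "\<exists>y. DERIV h t :> y \<and> y \<le> 0" using hd by (intro exI[of _ "D (x + t *\<^sub>R v) \<bullet> v - D x \<bullet> v - L * t * (norm v)\<^sup>2"]) auto
  qed simp
  then show ?thesis by (simp add: h_def)
qed

section \<open>Series of martingale differences\<close>

text \<open>The convergence theorem for martingales bounded in L2. The martingale property enters as
  orthogonality to square integrable functions of the past, which is the form in which the variance
  computation uses it. A maximal inequality bounds the probability that the partial sums starting at
  \<open>m\<close> ever reach \<open>\<epsilon>\<close> by a tail of the variances, so almost every
  path is Cauchy.\<close>

lemma summable_L2_martingale_differences:
  fixes e :: "nat \<Rightarrow> 'w \<Rightarrow> real" and F :: "nat \<Rightarrow> 'w measure"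
  assumes prob: "prob_space M"
    and sub: "\<And>k. subalgebra M (F k)"
    and mono: "\<And>j k. j \<le> k \<Longrightarrow> sets (F j) \<subseteq> sets (F k)"
    and adapt: "\<And>k. e k \<in> borel_measurable (F (Suc k))"
    and sq: "\<And>k. integrable M (\<lambda>\<omega>. (e k \<omega>)\<^sup>2)"
    and orth: "\<And>k Y. Y \<in> borel_measurable (F k) \<Longrightarrow> integrable M (\<lambda>\<omega>. (Y \<omega>)\<^sup>2) \<Longrightarrow>
      (\<integral>\<omega>. Y \<omega> * e k \<omega> \<partial>M) = 0"
    and sum: "summable (\<lambda>k. \<integral>\<omega>. (e k \<omega>)\<^sup>2 \<partial>M)"
  shows "AE \<omega> in M. summable (\<lambda>k. e k \<omega>)"
proof -
  interpret prob_space M by (rule prob)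
  define V where "V k = (\<integral>\<omega>. (e k \<omega>)\<^sup>2 \<partial>M)" for k
  have V0: "0 \<le> V k" for k by (simp add: V_def)
  have Fmono: "f \<in> borel_measurable (F k)" if "f \<in> borel_measurable (F j)" "j \<le> k" for f :: "'w \<Rightarrow> real" and j k
  proof -
    have "subalgebra (F k) (F j)" using sub[of j] sub[of k] mono[OF that(2)] by (auto simp: subalgebra_def)
    then show ?thesis using that(1) by (rule measurable_from_subalg)
  qed
  have FM: "f \<in> borel_measurable M" if "f \<in> borel_measurable (F j)" for f :: "'w \<Rightarrow> real" and j
    using measurable_from_subalg[OF sub that] .
  have eM[measurable]: "e k \<in> borel_measurable M" for k using FM[OF adapt] .
  define S where "S m n \<omega> = (\<Sum>k=m..<n. e k \<omega>)" for m n \<omega>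
  have S_adapt: "S m j \<in> borel_measurable (F k)" if "j \<le> k" for m j k
    unfolding S_def using that by (intro borel_measurable_sum Fmono[OF adapt]) auto
  text \<open>Kolmogorov's inequality, for the process stopped when it first leaves the interval.\<close>
  have maximal: "prob {\<omega>\<in>space M. \<exists>j\<in>{m..n}. \<epsilon> \<le> \<bar>S m j \<omega>\<bar>} \<le> (\<Sum>k=m..<n. V k) / \<epsilon>\<^sup>2"
    if \<epsilon>: "0 < \<epsilon>" and mn: "m \<le> n" for m n \<epsilon>
  proof -
    \<comment> \<open>\<open>I k\<close> records that no exit has happened up to index
      \<open>k\<close>. The sums \<open>S m j\<close> with \<open>j \<le> k\<close> involve only
      \<open>e\<close> at indices below \<open>k\<close>, so \<open>I k\<close> is known at time
      \<open>k\<close> and \<open>I k * e k\<close> stays orthogonal to the past.\<close>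
    define I where "I k \<omega> = (if \<forall>j\<in>{m..k}. \<bar>S m j \<omega>\<bar> < \<epsilon> then 1 else 0::real)" for k \<omega>
    define Z where "Z n \<omega> = (\<Sum>k=m..<n. I k \<omega> * e k \<omega>)" for n \<omega>
    have I_adapt: "I k \<in> borel_measurable (F k)" for k
    proof -
      have [measurable]: "S m j \<in> borel_measurable (F k)" if "j \<in> {m..k}" for j using that by (intro S_adapt) auto
      show ?thesis unfolding I_def by measurable
    qed
    have Z_adapt: "Z k \<in> borel_measurable (F k)" for k
      unfolding Z_def by (intro borel_measurable_sum borel_measurable_times Fmono[OF I_adapt] Fmono[OF adapt]) auto
    have I01: "I k \<omega> = 0 \<or> I k \<omega> = 1" for k \<omega> by (simp add: I_def)
    note [measurable] = FM[OF I_adapt] FM[OF Z_adapt]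
    have Ie: "(I k \<omega> * e k \<omega>)\<^sup>2 \<le> (e k \<omega>)\<^sup>2" for k \<omega> using I01[of k \<omega>] by auto
    have Z: "integrable M (\<lambda>\<omega>. (Z n \<omega>)\<^sup>2) \<and> (\<integral>\<omega>. (Z n \<omega>)\<^sup>2 \<partial>M) \<le> (\<Sum>k=m..<n. V k)" if "m \<le> n" for n
      using that
    proof (induction n rule: dec_induct)
      case base then show ?case by (simp add: Z_def)
    next
      case (step k)
      have Zk: "integrable M (\<lambda>\<omega>. (Z k \<omega>)\<^sup>2)" using step by simp
      have Z_Suc: "Z (Suc k) \<omega> = Z k \<omega> + I k \<omega> * e k \<omega>" for \<omega> using step by (simp add: Z_def)
      have i1: "integrable M (\<lambda>\<omega>. (I k \<omega> * e k \<omega>)\<^sup>2)"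
        by (rule Bochner_Integration.integrable_bound[OF sq[of k]]) (use Ie in auto)
      have IZ: "(I k \<omega> * Z k \<omega>)\<^sup>2 \<le> (Z k \<omega>)\<^sup>2" for \<omega> using I01[of k \<omega>] by auto
      have i2': "integrable M (\<lambda>\<omega>. (I k \<omega> * Z k \<omega>)\<^sup>2)"
        by (rule Bochner_Integration.integrable_bound[OF Zk]) (use IZ in auto)
      have i2: "integrable M (\<lambda>\<omega>. (I k \<omega> * Z k \<omega>) * e k \<omega>)"
      proof (rule Bochner_Integration.integrable_bound)
        show "integrable M (\<lambda>\<omega>. (I k \<omega> * Z k \<omega>)\<^sup>2 + (e k \<omega>)\<^sup>2)" using i2' sq by simp
        have "\<bar>a * b\<bar> \<le> a\<^sup>2 + b\<^sup>2" for a b :: real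
          using sum_squares_bound[of "\<bar>a\<bar>" "\<bar>b\<bar>"] mult_nonneg_nonneg[of "\<bar>a\<bar>" "\<bar>b\<bar>"]
          by (simp only: abs_mult power2_abs) linarith
        then show "AE \<omega> in M. norm (I k \<omega> * Z k \<omega> * e k \<omega>) \<le> norm ((I k \<omega> * Z k \<omega>)\<^sup>2 + (e k \<omega>)\<^sup>2)" by simp
      qed measurable
      have o: "(\<integral>\<omega>. (I k \<omega> * Z k \<omega>) * e k \<omega> \<partial>M) = 0"
        by (intro orth i2' borel_measurable_times I_adapt Z_adapt)
      \<comment> \<open>The cross term is written as \<open>e k\<close> against the
        \<open>F k\<close>-measurable factor \<open>I k * Z k\<close>, so that orthogonality removes
        it and the second moments add up.\<close>
      have eq: "(Z (Suc k) \<omega>)\<^sup>2 = ((Z k \<omega>)\<^sup>2 + (I k \<omega> * e k \<omega>)\<^sup>2) + 2 * ((I k \<omega> * Z k \<omega>) * e k \<omega>)" for \<omega>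
        unfolding Z_Suc by (simp add: power2_eq_square algebra_simps)
      have "(\<integral>\<omega>. (Z (Suc k) \<omega>)\<^sup>2 \<partial>M) = (\<integral>\<omega>. (Z k \<omega>)\<^sup>2 \<partial>M) + (\<integral>\<omega>. (I k \<omega> * e k \<omega>)\<^sup>2 \<partial>M)"
        unfolding eq using Zk i1 i2 o by simp
      also have "\<dots> \<le> (\<Sum>k=m..<k. V k) + V k"
        unfolding V_def using step.IH[unfolded V_def] Ie by (intro add_mono integral_mono i1 sq) auto
      finally show ?case unfolding eq using step Zk i1 i2 by simp
    qed
    \<comment> \<open>With \<open>t\<close> the first exit, the factors \<open>I\<close> are 1
      before \<open>t\<close> and 0 from \<open>t\<close> on; thus \<open>Z n\<close> is frozen at
      \<open>S m t\<close> and still witnesses the exit at time \<open>n\<close>.\<close>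
    have stop: "\<epsilon>\<^sup>2 \<le> (Z n \<omega>)\<^sup>2" if "\<exists>j\<in>{m..n}. \<epsilon> \<le> \<bar>S m j \<omega>\<bar>" for \<omega>
    proof -
      define t where "t = (LEAST j. j \<in> {m..n} \<and> \<epsilon> \<le> \<bar>S m j \<omega>\<bar>)"
      have t: "t \<in> {m..n} \<and> \<epsilon> \<le> \<bar>S m t \<omega>\<bar>" unfolding t_def by (rule LeastI_ex) (use that in auto)
      have before: "\<bar>S m j \<omega>\<bar> < \<epsilon>" if "m \<le> j" "j < t" for j
        using not_less_Least[of j "\<lambda>j. j \<in> {m..n} \<and> \<epsilon> \<le> \<bar>S m j \<omega>\<bar>"] that t
        unfolding t_def[symmetric] by auto
      have I1: "I k \<omega> = 1" if "k \<in> {m..<t}" for k using that before by (auto simp: I_def)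
      have I0: "I k \<omega> = 0" if "k \<in> {t..<n}" for k using that t by (force simp: I_def)
      have "Z n \<omega> = (\<Sum>k=m..<t. I k \<omega> * e k \<omega>) + (\<Sum>k=t..<n. I k \<omega> * e k \<omega>)"
        unfolding Z_def using t by (intro sum.atLeastLessThan_concat[symmetric]) auto
      also have "\<dots> = S m t \<omega>" using I1 I0 by (simp add: S_def)
      finally have "\<epsilon> \<le> \<bar>Z n \<omega>\<bar>" using t by simp
      then show ?thesis using \<epsilon> by (metis less_imp_le power2_abs power_mono)
    qed
    have "prob {\<omega>\<in>space M. \<exists>j\<in>{m..n}. \<epsilon> \<le> \<bar>S m j \<omega>\<bar>} \<le> prob {\<omega>\<in>space M. \<epsilon>\<^sup>2 \<le> (Z n \<omega>)\<^sup>2}"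
      by (intro finite_measure_mono) (use stop in auto)
    also have "\<dots> \<le> (\<integral>\<omega>. (Z n \<omega>)\<^sup>2 \<partial>M) / \<epsilon>\<^sup>2"
      by (rule integral_Markov_inequality_measure[of _ _ "{}"]) (use Z mn \<epsilon> in auto)
    also have "\<dots> \<le> (\<Sum>k=m..<n. V k) / \<epsilon>\<^sup>2" using Z[OF mn] \<epsilon> by (intro divide_right_mono) auto
    finally show ?thesis .
  qed
  have SM[measurable]: "S m j \<in> borel_measurable M" for m j using FM[OF S_adapt[OF order_refl]] .
  have tail: "prob {\<omega>\<in>space M. \<exists>j\<ge>m. \<epsilon> \<le> \<bar>S m j \<omega>\<bar>} \<le> (\<Sum>k. V (k + m)) / \<epsilon>\<^sup>2" if \<epsilon>: "0 < \<epsilon>" for m \<epsilon>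
  proof (rule LIMSEQ_le_const2)
    let ?A = "\<lambda>n. {\<omega>\<in>space M. \<exists>j\<in>{m..n}. \<epsilon> \<le> \<bar>S m j \<omega>\<bar>}"
    have "(\<lambda>n. prob (?A n)) \<longlonglongrightarrow> prob (\<Union>n. ?A n)"
    proof (rule finite_Lim_measure_incseq)
      show "range ?A \<subseteq> events" by auto
      show "incseq ?A" unfolding incseq_def by (auto intro: order_trans)
    qed
    also have "(\<Union>n. ?A n) = {\<omega>\<in>space M. \<exists>j\<ge>m. \<epsilon> \<le> \<bar>S m j \<omega>\<bar>}"
      by (auto intro: exI[of _ "_ :: nat"] simp: Bex_def)
    finally show "(\<lambda>n. prob (?A n)) \<longlonglongrightarrow> prob {\<omega>\<in>space M. \<exists>j\<ge>m. \<epsilon> \<le> \<bar>S m j \<omega>\<bar>}" .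
    show "\<exists>N. \<forall>n\<ge>N. prob (?A n) \<le> (\<Sum>k. V (k + m)) / \<epsilon>\<^sup>2"
    proof (intro exI allI impI)
      fix n assume n: "m \<le> n"
      have "(\<Sum>k=m..<n. V k) = (\<Sum>k<n-m. V (k + m))"
        using n by (intro sum.reindex_bij_witness[of _ "\<lambda>k. k + m" "\<lambda>k. k - m"]) auto
      also have "\<dots> \<le> (\<Sum>k. V (k + m))"
        using sum V0 by (intro sum_le_suminf) (auto simp: V_def[symmetric] summable_iff_shift[of V m])
      finally show "prob (?A n) \<le> (\<Sum>k. V (k + m)) / \<epsilon>\<^sup>2"
        using maximal[OF \<epsilon> n] \<epsilon> by (meson divide_right_mono order_trans zero_le_power2)
    qed
  qed
  \<comment> \<open>Countably many thresholds suffice for the Cauchy property and keep the union of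
    the exceptional sets null. For each one, the bad event lies in the tail events of all
    \<open>m\<close>, whose probabilities tend to 0.\<close>
  have "AE \<omega> in M. \<forall>p. \<exists>m. \<forall>j\<ge>m. \<bar>S m j \<omega>\<bar> < 1 / real (Suc p)"
    unfolding AE_all_countable
  proof
    fix p
    define \<epsilon> where "\<epsilon> = 1 / real (Suc p)"
    have \<epsilon>: "0 < \<epsilon>" by (simp add: \<epsilon>_def)
    let ?N = "{\<omega>\<in>space M. \<forall>m. \<exists>j\<ge>m. \<epsilon> \<le> \<bar>S m j \<omega>\<bar>}"
    have "prob ?N \<le> 0"
    proof (rule LIMSEQ_le_const)
      have "(\<lambda>m. \<Sum>k. V (k + m)) \<longlonglongrightarrow> 0"
        using suminf_exist_split2[of V] sum unfolding V_def[abs_def] by blast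
      then have "(\<lambda>m. (\<Sum>k. V (k + m)) / \<epsilon>\<^sup>2) \<longlonglongrightarrow> 0 / \<epsilon>\<^sup>2" using \<epsilon> by (intro tendsto_divide tendsto_const) auto
      then show "(\<lambda>m. (\<Sum>k. V (k + m)) / \<epsilon>\<^sup>2) \<longlonglongrightarrow> 0" by simp
      show "\<exists>N. \<forall>m\<ge>N. prob ?N \<le> (\<Sum>k. V (k + m)) / \<epsilon>\<^sup>2"
      proof (intro exI allI impI)
        fix m
        have "prob ?N \<le> prob {\<omega>\<in>space M. \<exists>j\<ge>m. \<epsilon> \<le> \<bar>S m j \<omega>\<bar>}" by (intro finite_measure_mono) auto
        then show "prob ?N \<le> (\<Sum>k. V (k + m)) / \<epsilon>\<^sup>2" using tail[OF \<epsilon>] order_trans by blast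
      qed
    qed
    then have "prob ?N = 0" using measure_nonneg[of M ?N] by linarith
    then have "AE \<omega> in M. \<omega> \<notin> ?N" by (subst AE_iff_measurable[OF _ refl]) (auto simp: emeasure_eq_measure)
    then show "AE \<omega> in M. \<exists>m. \<forall>j\<ge>m. \<bar>S m j \<omega>\<bar> < 1 / real (Suc p)"
      unfolding \<epsilon>_def[symmetric] using AE_space
    proof eventually_elim
      case (elim \<omega>)
      then obtain m where "\<forall>j\<ge>m. \<not> \<epsilon> \<le> \<bar>S m j \<omega>\<bar>" by blast
      then show ?case by (intro exI[of _ m]) (simp add: not_le)
    qed
  qed
  then show ?thesis
  proof (rule AE_mp, intro AE_I2 impI)
    fix \<omega> assume C: "\<forall>p. \<exists>m. \<forall>j\<ge>m. \<bar>S m j \<omega>\<bar> < 1 / real (Suc p)"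
    show "summable (\<lambda>k. e k \<omega>)"
      unfolding summable_Cauchy
    proof (intro allI impI)
      fix r :: real assume "0 < r"
      then obtain p where p: "1 / real (Suc p) < r / 2" using nat_approx_posE[of "r/2"] by auto
      obtain m where m: "\<And>j. j \<ge> m \<Longrightarrow> \<bar>S m j \<omega>\<bar> < r / 2" using C p by (meson less_trans)
      have "norm (\<Sum>k=a..<b. e k \<omega>) < r" if "a \<ge> m" for a b
      proof (cases "a \<le> b")
        case True
        have "S m a \<omega> + (\<Sum>k=a..<b. e k \<omega>) = S m b \<omega>"
          unfolding S_def using that True by (intro sum.atLeastLessThan_concat) auto
        then show ?thesis using m[of a] m[of b] that True by simp
      qed (use \<open>0 < r\<close> in simp)
      then show "\<exists>N. \<forall>m\<ge>N. \<forall>n. norm (\<Sum>k=m..<n. e k \<omega>) < r" by blast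
    qed
  qed
qed

section \<open>Conditional independence\<close>

text \<open>The positive and the negative part of \<open>u\<close> have the same image measure under \<open>X\<close>.\<close>

lemma integral_comp_mult_eq_0:
  fixes u :: "'w \<Rightarrow> real" and f :: "'b \<Rightarrow> real"
  assumes u: "integrable M u" and X[measurable]: "X \<in> measurable M N"
    and f[measurable]: "f \<in> borel_measurable N" and fu: "integrable M (\<lambda>\<omega>. f (X \<omega>) * u \<omega>)"
    and 0: "\<And>A. A \<in> sets N \<Longrightarrow> (\<integral>\<omega>. indicator A (X \<omega>) * u \<omega> \<partial>M) = 0"
  shows "(\<integral>\<omega>. f (X \<omega>) * u \<omega> \<partial>M) = 0"
proof -
  have [measurable]: "u \<in> borel_measurable M" using u by simp
  define p where "p \<omega> = max (u \<omega>) 0" for \<omega>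
  define n where "n \<omega> = max (- u \<omega>) 0" for \<omega>
  have [measurable]: "p \<in> borel_measurable M" "n \<in> borel_measurable M" unfolding p_def n_def by measurable
  have pn: "0 \<le> p \<omega>" "0 \<le> n \<omega>" "u \<omega> = p \<omega> - n \<omega>" "p \<omega> \<le> \<bar>u \<omega>\<bar>" "n \<omega> \<le> \<bar>u \<omega>\<bar>" for \<omega>
    by (auto simp: p_def n_def)
  have dom: "integrable M (\<lambda>\<omega>. h \<omega> * q \<omega>)"
    if "integrable M (\<lambda>\<omega>. h \<omega> * u \<omega>)" "q = p \<or> q = n" and [measurable]: "h \<in> borel_measurable M" for h q
  proof (rule Bochner_Integration.integrable_bound[OF that(1)])
    show "(\<lambda>\<omega>. h \<omega> * q \<omega>) \<in> borel_measurable M" using that(2) by auto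
    show "AE \<omega> in M. norm (h \<omega> * q \<omega>) \<le> norm (h \<omega> * u \<omega>)"
      using that(2) pn by (auto simp: abs_mult intro!: mult_left_mono)
  qed
  let ?P = "\<lambda>q. distr (density M (\<lambda>\<omega>. ennreal (q \<omega>))) N X"
  have em: "emeasure (?P q) A = ennreal (\<integral>\<omega>. indicator A (X \<omega>) * q \<omega> \<partial>M)"
    if A[measurable]: "A \<in> sets N" and q: "q = p \<or> q = n" for A q
  proof -
    have [measurable]: "q \<in> borel_measurable M" and q0: "\<And>\<omega>. 0 \<le> q \<omega>" using q pn by auto
    have "integrable M (\<lambda>\<omega>. indicator A (X \<omega>) * u \<omega>)"
      by (rule Bochner_Integration.integrable_bound[OF u]) (auto simp: indicator_def)
    then have i: "integrable M (\<lambda>\<omega>. indicator A (X \<omega>) * q \<omega>)" by (rule dom[OF _ q]) measurable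
    have "emeasure (?P q) A = (\<integral>\<^sup>+\<omega>. ennreal (q \<omega>) * indicator (X -` A \<inter> space M) \<omega> \<partial>M)"
      by (simp add: emeasure_distr emeasure_density)
    also have "\<dots> = (\<integral>\<^sup>+\<omega>. ennreal (indicator A (X \<omega>) * q \<omega>) \<partial>M)"
      by (intro nn_integral_cong) (auto simp: indicator_def)
    also have "\<dots> = ennreal (\<integral>\<omega>. indicator A (X \<omega>) * q \<omega> \<partial>M)"
      by (rule nn_integral_eq_integral[OF i]) (use q0 in auto)
    finally show ?thesis .
  qed
  have eq: "?P p = ?P n"
  proof (rule measure_eqI)
    fix A assume "A \<in> sets (?P p)"
    then have A[measurable]: "A \<in> sets N" by simp
    have iu: "integrable M (\<lambda>\<omega>. indicator A (X \<omega>) * u \<omega>)"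
      by (rule Bochner_Integration.integrable_bound[OF u]) (auto simp: indicator_def)
    have ip: "integrable M (\<lambda>\<omega>. indicator A (X \<omega>) * p \<omega>)" by (rule dom[OF iu]) auto
    have in': "integrable M (\<lambda>\<omega>. indicator A (X \<omega>) * n \<omega>)" by (rule dom[OF iu]) auto
    have "(\<integral>\<omega>. indicator A (X \<omega>) * p \<omega> \<partial>M) - (\<integral>\<omega>. indicator A (X \<omega>) * n \<omega> \<partial>M) = 0"
      using 0[OF A] ip in' by (simp add: pn(3) right_diff_distrib)
    then show "emeasure (?P p) A = emeasure (?P n) A" using em[OF A] by simp
  qed simp
  have int: "(\<integral>x. f x \<partial>?P q) = (\<integral>\<omega>. f (X \<omega>) * q \<omega> \<partial>M)" if "q = p \<or> q = n" for q
  proof -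
    have [measurable]: "q \<in> borel_measurable M" and q0: "\<And>\<omega>. 0 \<le> q \<omega>" using that pn by auto
    have "(\<integral>x. f x \<partial>?P q) = (\<integral>\<omega>. f (X \<omega>) \<partial>density M (\<lambda>\<omega>. ennreal (q \<omega>)))" by (intro integral_distr) auto
    also have "\<dots> = (\<integral>\<omega>. q \<omega> *\<^sub>R f (X \<omega>) \<partial>M)" by (intro integral_density) (use q0 in auto)
    finally show ?thesis by (simp add: mult.commute)
  qed
  have "integrable M (\<lambda>\<omega>. f (X \<omega>) * p \<omega>)" "integrable M (\<lambda>\<omega>. f (X \<omega>) * n \<omega>)" by (auto intro!: dom[OF fu])
  then show ?thesis using int[of p] int[of n] eq by (simp add: pn(3) right_diff_distrib)
qed

text \<open>Passes from indicators, in which conditional independence is defined, to arbitrary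
  factors. \<open>integral_comp_mult_eq_0\<close> is applied three times: to reduce
  \<open>\<phi> (X \<omega>)\<close> to an indicator of \<open>X\<close>, then \<open>Y\<close> to
  an indicator of a set in \<open>F\<close>, then \<open>c (Z \<omega>)\<close> to an indicator of
  \<open>Z\<close>. At that point the definition applies.\<close>

lemma cond_indep_var_centered:
  fixes X :: "'w \<Rightarrow> 'a::topological_space" and Z :: "'w \<Rightarrow> 'b::topological_space" and c :: "'b \<Rightarrow> real"
    and b :: "'w \<Rightarrow> real" and \<phi> :: "'a \<Rightarrow> real"
  assumes prob: "prob_space M" and sub: "subalgebra M F"
    and indep: "cond_indep_var M F X Z"
    and X[measurable]: "X \<in> borel_measurable M" and Z[measurable]: "Z \<in> borel_measurable M"
    and c[measurable]: "c \<in> borel_measurable borel" and ic: "integrable M (\<lambda>\<omega>. c (Z \<omega>))"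
    and b: "b \<in> borel_measurable F" and ib: "integrable M b"
    and mean: "AE \<omega> in M. real_cond_exp M F (\<lambda>\<omega>. c (Z \<omega>)) \<omega> = b \<omega>"
    and Y: "Y \<in> borel_measurable F"
    and iY: "integrable M (\<lambda>\<omega>. Y \<omega> * (c (Z \<omega>) - b \<omega>))"
    and \<phi>[measurable]: "\<phi> \<in> borel_measurable borel"
    and i\<phi>: "integrable M (\<lambda>\<omega>. \<phi> (X \<omega>) * (Y \<omega> * (c (Z \<omega>) - b \<omega>)))"
  shows "(\<integral>\<omega>. \<phi> (X \<omega>) * (Y \<omega> * (c (Z \<omega>) - b \<omega>)) \<partial>M) = 0"
proof (rule integral_comp_mult_eq_0[OF iY X \<phi> i\<phi>])
  interpret prob_space M by (rule prob)
  interpret F: finite_measure_subalgebra M F by unfold_locales (rule sub)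
  have FM: "h \<in> borel_measurable M" if "h \<in> borel_measurable F" for h :: "'w \<Rightarrow> real"
    using measurable_from_subalg[OF sub that] .
  note [measurable] = FM[OF b] FM[OF Y]
  \<comment> \<open>The identity is regarded as a random variable with values in \<open>F\<close>,
    of which \<open>Y\<close> is a function; this is how the second reduction, to sets
    \<open>D\<close> in \<open>F\<close>, takes place.\<close>
  have id: "(\<lambda>\<omega>. \<omega>) \<in> measurable M F" using sub by (auto simp: subalgebra_def measurable_def)
  fix A :: "'a set" assume A[measurable]: "A \<in> sets borel"
  define W where "W = real_cond_exp M F (\<lambda>\<omega>. indicator A (X \<omega>))"
  have iA: "integrable M (\<lambda>\<omega>. indicator A (X \<omega>) :: real)" by (rule integrable_const_bound[of _ 1]) auto
  have WF: "W \<in> borel_measurable F" by (simp add: W_def)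
  note [measurable] = FM[OF WF]
  have W01: "AE \<omega> in M. 0 \<le> W \<omega> \<and> W \<omega> \<le> 1"
    unfolding W_def by (intro AE_conjI F.real_cond_exp_ge_c F.real_cond_exp_le_c iA) (auto simp: indicator_def)
  text \<open>Conditional independence allows \<open>indicator A (X \<omega>)\<close> to be replaced by \<open>W\<close>, and the centred
    variable is orthogonal to \<open>W\<close>, which is \<open>F\<close>-measurable.\<close>
  have key: "(\<integral>\<omega>. indicator D \<omega> * (indicator A (X \<omega>) * (c (Z \<omega>) - b \<omega>)) \<partial>M) = 0" if D: "D \<in> sets F" for D
  proof -
    have [measurable]: "D \<in> sets M" using D sub by (auto simp: subalgebra_def)
    have DF: "(indicator D :: 'w \<Rightarrow> real) \<in> borel_measurable F" using D by simp
    let ?u = "\<lambda>\<omega>. indicator D \<omega> * (indicator A (X \<omega>) - W \<omega>) :: real"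
    have bound: "integrable M (\<lambda>\<omega>. h \<omega> * g \<omega>)"
      if "integrable M g" "AE \<omega> in M. \<bar>h \<omega>\<bar> \<le> 1" and [measurable]: "h \<in> borel_measurable M" for h g :: "'w \<Rightarrow> real"
    proof (rule Bochner_Integration.integrable_bound[OF that(1)])
      show "AE \<omega> in M. norm (h \<omega> * g \<omega>) \<le> norm (g \<omega>)"
        using that(2) by eventually_elim (auto simp: abs_mult intro: mult_left_le_one_le)
    qed (use that(1) in measurable)
    have u1: "AE \<omega> in M. \<bar>?u \<omega>\<bar> \<le> 1" using W01 by eventually_elim (auto simp: indicator_def)
    have DW: "AE \<omega> in M. \<bar>indicator D \<omega> * W \<omega>\<bar> \<le> 1" using W01 by eventually_elim (auto simp: indicator_def)
    have iu: "integrable M ?u" by (rule integrable_const_bound[of _ 1]) (use u1 in auto)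
    have icu: "integrable M (\<lambda>\<omega>. c (Z \<omega>) * ?u \<omega>)"
      using bound[OF ic u1] by (simp add: mult.commute)
    \<comment> \<open>The third reduction, with weight \<open>?u\<close>. For an indicator of
      \<open>C\<close>, conditional independence factorizes the conditional expectation, and the
      factor \<open>W\<close>, being \<open>F\<close>-measurable, can stay while the other
      conditional expectation is removed under the integral.\<close>
    have "(\<integral>\<omega>. c (Z \<omega>) * ?u \<omega> \<partial>M) = 0"
    proof (rule integral_comp_mult_eq_0[OF iu Z c icu])
      fix C :: "'b set" assume C[measurable]: "C \<in> sets borel"
      have iC: "integrable M (\<lambda>\<omega>. indicator C (Z \<omega>) :: real)" by (rule integrable_const_bound[of _ 1]) auto
      have iAC: "integrable M (\<lambda>\<omega>. indicator A (X \<omega>) * indicator C (Z \<omega>) :: real)"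
        by (rule bound[OF iC]) auto
      have i1: "integrable M (\<lambda>\<omega>. indicator D \<omega> * (indicator A (X \<omega>) * indicator C (Z \<omega>)) :: real)"
        by (rule bound[OF iAC]) auto
      have i2: "integrable M (\<lambda>\<omega>. (indicator D \<omega> * W \<omega>) * indicator C (Z \<omega>))" by (rule bound[OF iC DW]) measurable
      have "(\<integral>\<omega>. indicator D \<omega> * (indicator A (X \<omega>) * indicator C (Z \<omega>)) \<partial>M) =
          (\<integral>\<omega>. indicator D \<omega> * real_cond_exp M F (\<lambda>\<omega>. indicator A (X \<omega>) * indicator C (Z \<omega>)) \<omega> \<partial>M)"
        by (rule F.real_cond_exp_intg(2)[symmetric, OF i1 DF]) measurable
      also have "\<dots> = (\<integral>\<omega>. (indicator D \<omega> * W \<omega>) * real_cond_exp M F (\<lambda>\<omega>. indicator C (Z \<omega>)) \<omega> \<partial>M)"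
      proof (rule integral_cong_AE)
        show "AE \<omega> in M. indicator D \<omega> * real_cond_exp M F (\<lambda>\<omega>. indicator A (X \<omega>) * indicator C (Z \<omega>)) \<omega> =
           (indicator D \<omega> * W \<omega>) * real_cond_exp M F (\<lambda>\<omega>. indicator C (Z \<omega>)) \<omega>"
          using indep[unfolded cond_indep_var_def, rule_format, OF A C] by eventually_elim (simp add: W_def)
      qed (auto simp: borel_measurable_cond_exp2)
      also have "\<dots> = (\<integral>\<omega>. (indicator D \<omega> * W \<omega>) * indicator C (Z \<omega>) \<partial>M)"
        by (rule F.real_cond_exp_intg(2)[OF i2]) (use DF WF in auto)
      finally have e: "(\<integral>\<omega>. indicator D \<omega> * (indicator A (X \<omega>) * indicator C (Z \<omega>)) \<partial>M) =
        (\<integral>\<omega>. (indicator D \<omega> * W \<omega>) * indicator C (Z \<omega>) \<partial>M)" .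
      have "(\<lambda>\<omega>. indicator C (Z \<omega>) * ?u \<omega>) = (\<lambda>\<omega>. indicator D \<omega> * (indicator A (X \<omega>) * indicator C (Z \<omega>)) -
         (indicator D \<omega> * W \<omega>) * indicator C (Z \<omega>))" by (auto simp: algebra_simps)
      then show "(\<integral>\<omega>. indicator C (Z \<omega>) * ?u \<omega> \<partial>M) = 0" using e i1 i2 by simp
    qed
    \<comment> \<open>Since \<open>b\<close> is \<open>F\<close>-measurable, replacing the indicator
      by \<open>W\<close> here is the defining property of conditional expectation.\<close>
    moreover have "(\<integral>\<omega>. b \<omega> * ?u \<omega> \<partial>M) = 0"
    proof -
      have j1: "integrable M (\<lambda>\<omega>. (indicator D \<omega> * b \<omega>) * indicator A (X \<omega>))"
        using bound[of b "\<lambda>\<omega>. indicator D \<omega> * indicator A (X \<omega>)"] ib by (simp add: indicator_def mult_ac)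
      have j2: "integrable M (\<lambda>\<omega>. (indicator D \<omega> * b \<omega>) * W \<omega>)"
        using bound[OF ib DW] by (simp add: mult_ac)
      have DbF: "(\<lambda>\<omega>. indicator D \<omega> * b \<omega>) \<in> borel_measurable F" using DF b by measurable
      have "(\<integral>\<omega>. (indicator D \<omega> * b \<omega>) * W \<omega> \<partial>M) = (\<integral>\<omega>. (indicator D \<omega> * b \<omega>) * indicator A (X \<omega>) \<partial>M)"
        unfolding W_def by (rule F.real_cond_exp_intg(2)[OF j1 DbF]) measurable
      moreover have "(\<lambda>\<omega>. b \<omega> * ?u \<omega>) = (\<lambda>\<omega>. (indicator D \<omega> * b \<omega>) * indicator A (X \<omega>) - (indicator D \<omega> * b \<omega>) * W \<omega>)"
        by (auto simp: algebra_simps)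
      ultimately show ?thesis using j1 j2 by simp
    qed
    moreover have "(\<integral>\<omega>. (indicator D \<omega> * W \<omega>) * (c (Z \<omega>) - b \<omega>) \<partial>M) = 0"
    proof -
      have k1: "integrable M (\<lambda>\<omega>. (indicator D \<omega> * W \<omega>) * c (Z \<omega>))" by (rule bound[OF ic DW]) measurable
      have k2: "integrable M (\<lambda>\<omega>. (indicator D \<omega> * W \<omega>) * b \<omega>)" by (rule bound[OF ib DW]) measurable
      have "(\<integral>\<omega>. (indicator D \<omega> * W \<omega>) * c (Z \<omega>) \<partial>M) =
          (\<integral>\<omega>. (indicator D \<omega> * W \<omega>) * real_cond_exp M F (\<lambda>\<omega>. c (Z \<omega>)) \<omega> \<partial>M)"
        by (rule F.real_cond_exp_intg(2)[symmetric, OF k1]) (use DF WF in auto)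
      also have "\<dots> = (\<integral>\<omega>. (indicator D \<omega> * W \<omega>) * b \<omega> \<partial>M)"
      proof (rule integral_cong_AE)
        show "AE \<omega> in M. (indicator D \<omega> * W \<omega>) * real_cond_exp M F (\<lambda>\<omega>. c (Z \<omega>)) \<omega> = (indicator D \<omega> * W \<omega>) * b \<omega>"
          using mean by eventually_elim simp
      qed (auto simp: borel_measurable_cond_exp2)
      finally show ?thesis using k1 k2 by (simp add: right_diff_distrib)
    qed
    moreover have ibu: "integrable M (\<lambda>\<omega>. b \<omega> * ?u \<omega>)"
      using bound[OF ib u1] by (simp add: mult.commute)
    moreover have "integrable M (\<lambda>\<omega>. (indicator D \<omega> * W \<omega>) * (c (Z \<omega>) - b \<omega>))"
      by (rule bound[OF _ DW]) (use ic ib in auto)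
    moreover have "(\<lambda>\<omega>. indicator D \<omega> * (indicator A (X \<omega>) * (c (Z \<omega>) - b \<omega>))) =
       (\<lambda>\<omega>. c (Z \<omega>) * ?u \<omega> - b \<omega> * ?u \<omega> + (indicator D \<omega> * W \<omega>) * (c (Z \<omega>) - b \<omega>))"
      by (auto simp: algebra_simps)
    ultimately show ?thesis using icu by simp
  qed
  have ikey: "integrable M (\<lambda>\<omega>. indicator A (X \<omega>) * (c (Z \<omega>) - b \<omega>))"
    by (rule Bochner_Integration.integrable_bound[of M "\<lambda>\<omega>. c (Z \<omega>) - b \<omega>"])
      (use ic ib in \<open>auto simp: indicator_def\<close>)
  have "integrable M (\<lambda>\<omega>. indicator A (X \<omega>) * (Y \<omega> * (c (Z \<omega>) - b \<omega>)))"
    by (rule Bochner_Integration.integrable_bound[OF iY]) (auto simp: indicator_def)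
  then have "integrable M (\<lambda>\<omega>. Y \<omega> * (indicator A (X \<omega>) * (c (Z \<omega>) - b \<omega>)))" by (simp add: mult_ac)
  from integral_comp_mult_eq_0[OF ikey id Y this key]
  show "(\<integral>\<omega>. indicator A (X \<omega>) * (Y \<omega> * (c (Z \<omega>) - b \<omega>)) \<partial>M) = 0" by (simp add: mult_ac)
qed

section \<open>Gradients and matrices\<close>

lemma GDERIV_unique:
  assumes "GDERIV f x :> a" "GDERIV f x :> b"
  shows "a = b"
proof -
  have "(\<lambda>h. h \<bullet> a) = (\<lambda>h. h \<bullet> b)" using assms unfolding gderiv_def by (rule has_derivative_unique)
  then have "(a - b) \<bullet> a = (a - b) \<bullet> b" by metis
  then have "(a - b) \<bullet> (a - b) = 0" by (simp add: inner_diff_right)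
  then show ?thesis by simp
qed

lemma GDERIV_grad:
  fixes f :: "'a::euclidean_space \<Rightarrow> real"
  assumes "f differentiable (at x)"
  shows "GDERIV f x :> grad f x"
proof -
  obtain f' where f': "(f has_derivative f') (at x)" using assms by (auto simp: differentiable_def)
  interpret bounded_linear f' using f' by (rule has_derivative_bounded_linear)
  have "f' h = h \<bullet> (\<Sum>b\<in>Basis. f' b *\<^sub>R b)" for h
  proof -
    have "f' h = f' (\<Sum>b\<in>Basis. (h \<bullet> b) *\<^sub>R b)" by (simp add: euclidean_representation)
    also have "\<dots> = h \<bullet> (\<Sum>b\<in>Basis. f' b *\<^sub>R b)" by (simp add: sum scaleR inner_sum_right mult.commute)
    finally show ?thesis .
  qed
  then have "f' = (\<lambda>h. h \<bullet> (\<Sum>b\<in>Basis. f' b *\<^sub>R b))" by (rule ext)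
  then have "GDERIV f x :> (\<Sum>b\<in>Basis. f' b *\<^sub>R b)" using f' by (simp add: gderiv_def)
  then show ?thesis unfolding grad_def by (rule theI) (blast intro: GDERIV_unique \<open>GDERIV f x :> _\<close>)
qed

text \<open>The gradient of a merely differentiable function may be discontinuous, but each of its
  coordinates is a pointwise limit of difference quotients with increments
  \<open>1 / (n + 1)\<close>, and these are Borel because \<open>f\<close> is continuous.\<close>

lemma borel_measurable_grad:
  fixes f :: "'a::euclidean_space \<Rightarrow> real"
  assumes f: "\<And>x. f differentiable (at x)"
  shows "grad f \<in> borel_measurable borel"
  unfolding borel_measurable_euclidean_space[of "grad f"]
proof
  fix b :: 'a
  have [measurable]: "f \<in> borel_measurable borel"
    by (intro borel_measurable_continuous_onI continuous_at_imp_continuous_on ballI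
        differentiable_imp_continuous_within f)
  show "(\<lambda>x. grad f x \<bullet> b) \<in> borel_measurable borel"
  proof (rule borel_measurable_LIMSEQ_real)
    fix x
    have "((\<lambda>t. f (x + t *\<^sub>R b)) has_derivative (\<lambda>s. (s *\<^sub>R b) \<bullet> grad f x)) (at 0)"
    proof (rule has_derivative_compose[of "\<lambda>t. x + t *\<^sub>R b" "\<lambda>s. s *\<^sub>R b" 0 UNIV f, simplified])
      show "((\<lambda>t. x + t *\<^sub>R b) has_derivative (\<lambda>s. s *\<^sub>R b)) (at 0)"
        by (auto intro!: derivative_eq_intros)
      show "(f has_derivative (\<lambda>h. h \<bullet> grad f x)) (at x)"
        using GDERIV_grad[OF f] by (simp add: gderiv_def)
    qed
    then have "DERIV (\<lambda>t. f (x + t *\<^sub>R b)) 0 :> grad f x \<bullet> b"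
      by (simp add: has_field_derivative_def inner_commute mult_commute_abs)
    then have "((\<lambda>h. (f (x + h *\<^sub>R b) - f x) / h) \<longlongrightarrow> grad f x \<bullet> b) (at 0)"
      by (simp add: DERIV_def)
    moreover have "filterlim (\<lambda>n. inverse (real (Suc n))) (at 0) sequentially"
      using LIMSEQ_inverse_real_of_nat by (auto simp: filterlim_at)
    ultimately show "(\<lambda>n. (f (x + inverse (real (Suc n)) *\<^sub>R b) - f x) / inverse (real (Suc n))) \<longlonglongrightarrow> grad f x \<bullet> b"
      by (rule filterlim_compose)
  qed measurable
qed

section \<open>Measurability of matrix operations\<close>

lemma borel_measurable_matrix_iff:
  fixes f :: "'w \<Rightarrow> real ^ 'n ^ 'm"
  shows "f \<in> borel_measurable M \<longleftrightarrow> (\<forall>i j. (\<lambda>\<omega>. f \<omega> $ i $ j) \<in> borel_measurable M)"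
proof
  assume f: "f \<in> borel_measurable M"
  have "(\<lambda>x :: real ^ 'n ^ 'm. x $ i $ j) \<in> borel_measurable borel" for i j
    by (intro borel_measurable_continuous_onI continuous_intros)
  then show "\<forall>i j. (\<lambda>\<omega>. f \<omega> $ i $ j) \<in> borel_measurable M" using measurable_compose[OF f] by blast
next
  assume "\<forall>i j. (\<lambda>\<omega>. f \<omega> $ i $ j) \<in> borel_measurable M"
  then show "f \<in> borel_measurable M"
    by (subst borel_measurable_euclidean_space) (auto simp: Basis_vec_def inner_axis)
qed

lemma borel_measurable_matrix_nth[measurable (raw)]:
  fixes f :: "'w \<Rightarrow> real ^ 'n ^ 'm"
  assumes "f \<in> borel_measurable M"
  shows "(\<lambda>\<omega>. f \<omega> $ i $ j) \<in> borel_measurable M"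
  using assms by (simp add: borel_measurable_matrix_iff)

lemma borel_measurable_matrix_mult[measurable (raw)]:
  fixes f :: "'w \<Rightarrow> real ^ 'k ^ 'm" and g :: "'w \<Rightarrow> real ^ 'n ^ 'k"
  assumes [measurable]: "f \<in> borel_measurable M" "g \<in> borel_measurable M"
  shows "(\<lambda>\<omega>. f \<omega> ** g \<omega>) \<in> borel_measurable M"
  by (subst borel_measurable_matrix_iff) (simp add: matrix_matrix_mult_def)

lemma borel_measurable_transpose[measurable (raw)]:
  fixes f :: "'w \<Rightarrow> real ^ 'n ^ 'm"
  assumes [measurable]: "f \<in> borel_measurable M"
  shows "(\<lambda>\<omega>. transpose (f \<omega>)) \<in> borel_measurable M"
  by (subst borel_measurable_matrix_iff) (simp add: transpose_def)

lemma invertible_matrix_inv: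
  assumes "invertible A"
  shows "A ** matrix_inv A = mat 1 \<and> matrix_inv A ** A = mat 1"
  using assms unfolding invertible_def matrix_inv_def by (rule someI_ex)

lemma matrix_inv_unique:
  fixes A :: "real ^ 'm ^ 'm"
  assumes "A ** B = mat 1" "B ** A = mat 1"
  shows "matrix_inv A = B"
proof -
  have "invertible A" using assms by (auto simp: invertible_def)
  then have "matrix_inv A ** (A ** B) = B"
    using invertible_matrix_inv[of A] by (simp add: matrix_mul_assoc)
  then show ?thesis using assms by simp
qed

text \<open>On singular matrices \<open>matrix_inv\<close> is the choice from an empty predicate, hence constant;
  on the others Cramer's rule makes it a rational function of the entries.\<close>

lemma borel_measurable_matrix_inv[measurable]:
  "(matrix_inv :: real ^ 'm ^ 'm \<Rightarrow> _) \<in> borel_measurable borel"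
proof -
  \<comment> \<open>Column \<open>l\<close> of \<open>Q A\<close> is Cramer's solution of
    \<open>A *v x = axis l 1\<close>.\<close>
  define Q :: "real ^ 'm ^ 'm \<Rightarrow> real ^ 'm ^ 'm" where
    "Q A = (\<chi> k l. det (\<chi> i j. if j = k then axis l 1 $ i else A $ i $ j) / det A)" for A
  define S :: "real ^ 'm ^ 'm" where "S = (SOME A'. False)"
  have "matrix_inv A = (if det A = 0 then S else Q A)" for A
  proof (cases "det A = 0")
    case True
    then have "\<not> invertible A" by (simp add: invertible_det_nz)
    then have "(\<lambda>A'. A ** A' = mat 1 \<and> A' ** A = mat 1) = (\<lambda>_. False)" by (auto simp: invertible_def)
    then show ?thesis using True by (simp add: matrix_inv_def S_def)
  next
    case False
    have col: "A *v column l (Q A) = axis l 1" for l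
      unfolding cramer[OF False] by (simp add: Q_def column_def)
    have "(A ** Q A) $ i $ l = (mat 1 :: real ^ 'm ^ 'm) $ i $ l" for i l
    proof -
      have "(A ** Q A) $ i $ l = (A *v column l (Q A)) $ i"
        by (simp add: matrix_matrix_mult_def matrix_vector_mult_def column_def)
      then show ?thesis unfolding col by (simp add: axis_def mat_def)
    qed
    then have "A ** Q A = mat 1" by (simp add: vec_eq_iff)
    moreover from this have "Q A ** A = mat 1" by (simp add: matrix_left_right_inverse)
    ultimately show ?thesis using False by (simp add: matrix_inv_unique)
  qed
  then have eq: "matrix_inv = (\<lambda>A. if det A = 0 then S else Q A)" by (rule ext)
  have det: "(\<lambda>\<omega>. det (f \<omega>)) \<in> borel_measurable N"
    if "\<And>i j. (\<lambda>\<omega>. f \<omega> $ i $ j) \<in> borel_measurable N" for f :: "'b \<Rightarrow> real ^ 'm ^ 'm" and N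
    unfolding det_def using that by (intro borel_measurable_sum borel_measurable_times borel_measurable_const borel_measurable_prod)
  have [measurable]: "(det :: real ^ 'm ^ 'm \<Rightarrow> real) \<in> borel_measurable borel" by (rule det) measurable
  have [measurable]: "Q \<in> borel_measurable borel"
    unfolding borel_measurable_matrix_iff[of Q] Q_def
    by (simp, intro allI borel_measurable_divide det) auto
  show ?thesis unfolding eq by measurable
qed

section \<open>Frobenius inner products by columns, and Loewner bounds for inverses\<close>

lemma inner_matrix_columns:
  fixes Z W :: "real ^ 'n ^ 'm"
  shows "Z \<bullet> W = (\<Sum>j\<in>UNIV. column j Z \<bullet> column j W)"
  by (simp add: inner_vec_def column_def) (rule sum.swap)

lemma column_matrix_mult: "column j (A ** Z) = A *v column j Z"
  by (simp add: vec_eq_iff column_def matrix_matrix_mult_def matrix_vector_mult_def)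

lemma inner_matrix_mult_transpose:
  fixes A :: "real ^ 'k ^ 'm" and Z :: "real ^ 'n ^ 'm" and W :: "real ^ 'n ^ 'k"
  shows "Z \<bullet> (A ** W) = (transpose A ** Z) \<bullet> W"
  by (simp add: inner_matrix_columns column_matrix_mult dot_lmul_matrix[symmetric] vector_transpose_matrix)

lemma norm_matrix_columns:
  fixes Z :: "real ^ 'n ^ 'm"
  shows "(norm Z)\<^sup>2 = (\<Sum>j\<in>UNIV. (norm (column j Z))\<^sup>2)"
  by (simp add: power2_norm_eq_inner inner_matrix_columns)

text \<open>With \<open>v = matrix_inv A *v w\<close>, the first bound is the lower Loewner bound at
  \<open>v\<close>. The second comes from nonnegativity of the quadratic form of \<open>A\<close> at
  \<open>v - r *\<^sub>R w\<close>, expanded with the symmetry of \<open>A\<close>, after the upper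
  Loewner bound at \<open>w\<close>.\<close>

lemma matrix_inv_loewner:
  fixes A :: "real ^ 'm ^ 'm" and w :: "real ^ 'm"
  assumes h1: "0 < h1" and lo: "h1 *\<^sub>R mat 1 \<preceq>\<^sub>L A" and h2: "0 < h2" and hi: "A \<preceq>\<^sub>L h2 *\<^sub>R mat 1"
  shows "h1 * (norm (matrix_inv A *v w))\<^sup>2 \<le> w \<bullet> (matrix_inv A *v w)"
    and "(norm w)\<^sup>2 / h2 \<le> w \<bullet> (matrix_inv A *v w)"
proof -
  have lo': "h1 * (v \<bullet> v) \<le> v \<bullet> (A *v v)" for v
    using lo by (simp add: loewner_le_def psd_def matrix_vector_mult_diff_rdistrib inner_diff_right
      scaleR_matrix_vector_assoc[symmetric])
  have hi': "v \<bullet> (A *v v) \<le> h2 * (v \<bullet> v)" for v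
    using hi by (simp add: loewner_le_def psd_def matrix_vector_mult_diff_rdistrib inner_diff_right
      scaleR_matrix_vector_assoc[symmetric])
  have tr: "transpose (A - h1 *\<^sub>R mat 1) = A - h1 *\<^sub>R mat 1" using lo by (simp add: loewner_le_def psd_def)
  have symm: "transpose A = A"
  proof (intro vec_eq_iff[THEN iffD2] allI)
    fix i j
    show "transpose A $ i $ j = A $ i $ j"
      using arg_cong[OF tr, of "\<lambda>X. X $ i $ j"] by (cases "i = j") (simp_all add: transpose_def mat_def)
  qed
  have "A *v x = 0 \<Longrightarrow> x = 0" for x using lo'[of x] h1 inner_ge_zero[of x]
    by (simp add: mult_le_0_iff)
  then have "invertible A" using matrix_left_invertible_ker[of A] invertible_left_inverse[of A] by blast
  then have inv: "A *v (matrix_inv A *v w) = w"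
    by (simp add: invertible_matrix_inv matrix_vector_mul_assoc)
  define v where "v = matrix_inv A *v w"
  have w: "w = A *v v" using inv by (simp add: v_def)
  show "h1 * (norm (matrix_inv A *v w))\<^sup>2 \<le> w \<bullet> (matrix_inv A *v w)"
    unfolding v_def[symmetric] using lo'[of v] by (simp add: w power2_norm_eq_inner inner_commute)
  have adj: "v \<bullet> (A *v u) = (A *v v) \<bullet> u" for u
    using dot_lmul_matrix[of v A u] symm by (simp add: vector_transpose_matrix[symmetric])
  \<comment> \<open>The expansion yields \<open>v \<bullet> w \<ge> (2 * r - h2 * r\<^sup>2) * (w
    \<bullet> w)\<close>; this choice of \<open>r\<close> maximizes the factor, with value
    \<open>1 / h2\<close>.\<close>
  define r where "r = 1 / h2"
  let ?u = "v - r *\<^sub>R w"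
  have "0 \<le> ?u \<bullet> (A *v ?u)" using lo'[of ?u] h1 by (meson inner_ge_zero less_imp_le mult_nonneg_nonneg order_trans)
  also have "\<dots> = v \<bullet> w - 2 * r * (w \<bullet> w) + r\<^sup>2 * (w \<bullet> (A *v w))"
    by (simp add: matrix_vector_mult_diff_distrib matrix_vector_mult_scaleR inner_diff_left inner_diff_right adj w[symmetric]
       power2_eq_square algebra_simps)
  also have "r\<^sup>2 * (w \<bullet> (A *v w)) \<le> r\<^sup>2 * (h2 * (w \<bullet> w))" by (intro mult_left_mono hi') simp
  finally have "0 \<le> v \<bullet> w - (1 / h2) * (w \<bullet> w)" using h2 by (simp add: r_def power2_eq_square field_simps)
  then show "(norm w)\<^sup>2 / h2 \<le> w \<bullet> (matrix_inv A *v w)"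
    unfolding v_def[symmetric] by (simp add: power2_norm_eq_inner inner_commute)
qed

text \<open>The first two bounds are sums of the vector bounds over the columns of \<open>Z\<close>.
  The third follows from the first by Cauchy-Schwarz, after cancelling one factor
  \<open>norm (matrix_inv A ** Z)\<close>.\<close>

lemma matrix_inv_loewner_mult:
  fixes A :: "real ^ 'm ^ 'm" and Z :: "real ^ 'n ^ 'm"
  assumes h1: "0 < h1" and lo: "h1 *\<^sub>R mat 1 \<preceq>\<^sub>L A" and h2: "0 < h2" and hi: "A \<preceq>\<^sub>L h2 *\<^sub>R mat 1"
  shows "h1 * (norm (matrix_inv A ** Z))\<^sup>2 \<le> Z \<bullet> (matrix_inv A ** Z)"
    and "(norm Z)\<^sup>2 / h2 \<le> Z \<bullet> (matrix_inv A ** Z)"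
    and "norm (matrix_inv A ** Z) \<le> norm Z / h1"
proof -
  note v = matrix_inv_loewner[OF assms]
  show 1: "h1 * (norm (matrix_inv A ** Z))\<^sup>2 \<le> Z \<bullet> (matrix_inv A ** Z)"
    unfolding norm_matrix_columns inner_matrix_columns sum_distrib_left column_matrix_mult by (intro sum_mono v)
  show "(norm Z)\<^sup>2 / h2 \<le> Z \<bullet> (matrix_inv A ** Z)"
    unfolding norm_matrix_columns inner_matrix_columns sum_divide_distrib column_matrix_mult by (intro sum_mono v)
  show "norm (matrix_inv A ** Z) \<le> norm Z / h1"
  proof (cases "matrix_inv A ** Z = 0")
    case True then show ?thesis using h1 by simp
  next
    case False
    have "h1 * (norm (matrix_inv A ** Z))\<^sup>2 \<le> norm Z * norm (matrix_inv A ** Z)"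
      using 1 norm_cauchy_schwarz order_trans by blast
    then have "(h1 * norm (matrix_inv A ** Z)) * norm (matrix_inv A ** Z) \<le> norm Z * norm (matrix_inv A ** Z)"
      by (simp add: power2_eq_square mult_ac)
    then have "h1 * norm (matrix_inv A ** Z) \<le> norm Z" using False by (simp add: mult_le_cancel_right)
    then show ?thesis using h1 by (simp add: field_simps)
  qed
qed

lemma norm_matrix_nth_le: "\<bar>Z $ i $ j\<bar> \<le> norm (Z :: real ^ 'n ^ 'm)"
  using component_le_norm_cart[of "Z $ i" j] Finite_Cartesian_Product.norm_nth_le[where x = Z and i = i] by simp

section \<open>Histories and square integrable functions\<close>

lemma space_history[simp]: "space (history M X k) = space M"
  by (simp add: history_def space_measure_of_conv)

lemma sets_history:
  "sets (history M X k) = sigma_sets (space M) (\<Union>j\<in>{..k}. {X j -` A \<inter> space M | A. A \<in> sets borel})"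
  unfolding history_def by (rule sets_measure_of) auto

lemma subalgebra_history:
  assumes "\<And>j. X j \<in> borel_measurable M"
  shows "subalgebra M (history M X k)"
  unfolding subalgebra_def sets_history using measurable_sets[OF assms]
  by (auto intro!: sets.sigma_sets_subset)

lemma sets_history_mono: "j \<le> k \<Longrightarrow> sets (history M X j) \<subseteq> sets (history M X k)"
  unfolding sets_history by (intro sigma_sets_mono' UN_mono) auto

lemma measurable_history:
  assumes "j \<le> k"
  shows "X j \<in> borel_measurable (history M X k)"
proof (rule measurableI)
  fix A :: "'b set" assume "A \<in> sets borel"
  then show "X j -` A \<inter> space (history M X k) \<in> sets (history M X k)"
    unfolding sets_history space_history using assms by (intro sigma_sets.Basic) auto
qed simp

text \<open>Measurability is demanded separately because integrability of the squared norm gives it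
  only for the norm, not for \<open>f\<close>.\<close>

definition sq_integrable :: "'w measure \<Rightarrow> ('w \<Rightarrow> 'a::euclidean_space) \<Rightarrow> bool" where
  "sq_integrable M f \<longleftrightarrow> f \<in> borel_measurable M \<and> integrable M (\<lambda>\<omega>. (norm (f \<omega>))\<^sup>2)"

lemma sq_integrable_measurable: "sq_integrable M f \<Longrightarrow> f \<in> borel_measurable M"
  by (simp add: sq_integrable_def)

lemma sq_integrable_square: "sq_integrable M f \<Longrightarrow> integrable M (\<lambda>\<omega>. (norm (f \<omega>))\<^sup>2)"
  by (simp add: sq_integrable_def)

lemma sq_integrable_bound:
  fixes f :: "'w \<Rightarrow> 'a::euclidean_space" and g :: "'w \<Rightarrow> 'b::euclidean_space"
  assumes f: "sq_integrable M f" and g[measurable]: "g \<in> borel_measurable M"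
    and le: "AE \<omega> in M. norm (g \<omega>) \<le> C * norm (f \<omega>)"
  shows "sq_integrable M g"
  unfolding sq_integrable_def
proof
  have [measurable]: "f \<in> borel_measurable M" using f by (rule sq_integrable_measurable)
  show "integrable M (\<lambda>\<omega>. (norm (g \<omega>))\<^sup>2)"
  proof (rule Bochner_Integration.integrable_bound)
    show "integrable M (\<lambda>\<omega>. C\<^sup>2 * (norm (f \<omega>))\<^sup>2)" using sq_integrable_square[OF f] by simp
    show "AE \<omega> in M. norm ((norm (g \<omega>))\<^sup>2) \<le> norm (C\<^sup>2 * (norm (f \<omega>))\<^sup>2)"
      using le
    proof eventually_elim
      case (elim \<omega>)
      then have "(norm (g \<omega>))\<^sup>2 \<le> (C * norm (f \<omega>))\<^sup>2" by (intro power_mono) auto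
      then show ?case by (simp add: power_mult_distrib)
    qed
  qed measurable
qed (rule g)

lemma norm_add_sq_le: "(norm (a + b))\<^sup>2 \<le> 2 * (norm a)\<^sup>2 + 2 * (norm (b :: 'a::real_inner))\<^sup>2"
proof -
  have "0 \<le> (a - b) \<bullet> (a - b)" by (rule inner_ge_zero)
  then show ?thesis
    by (simp add: power2_norm_eq_inner inner_add_left inner_add_right inner_diff_left inner_diff_right inner_commute[of b a])
qed

lemma sq_integrable_add:
  assumes f: "sq_integrable M f" and g: "sq_integrable M g"
  shows "sq_integrable M (\<lambda>\<omega>. f \<omega> + g \<omega>)"
  unfolding sq_integrable_def
proof
  note [measurable] = sq_integrable_measurable[OF f] sq_integrable_measurable[OF g]
  show "(\<lambda>\<omega>. f \<omega> + g \<omega>) \<in> borel_measurable M" by measurable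
  show "integrable M (\<lambda>\<omega>. (norm (f \<omega> + g \<omega>))\<^sup>2)"
  proof (rule Bochner_Integration.integrable_bound)
    show "integrable M (\<lambda>\<omega>. 2 * (norm (f \<omega>))\<^sup>2 + 2 * (norm (g \<omega>))\<^sup>2)"
      using sq_integrable_square[OF f] sq_integrable_square[OF g] by simp
    show "AE \<omega> in M. norm ((norm (f \<omega> + g \<omega>))\<^sup>2) \<le> norm (2 * (norm (f \<omega>))\<^sup>2 + 2 * (norm (g \<omega>))\<^sup>2)"
      using norm_add_sq_le[of "f _" "g _"] by simp
  qed measurable
qed

lemma sq_integrable_scaleR: "sq_integrable M f \<Longrightarrow> sq_integrable M (\<lambda>\<omega>. c *\<^sub>R f \<omega>)"
  by (rule sq_integrable_bound[where C = "\<bar>c\<bar>"]) (auto dest: sq_integrable_measurable)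

lemma sq_integrable_diff:
  assumes f: "sq_integrable M f" and g: "sq_integrable M g"
  shows "sq_integrable M (\<lambda>\<omega>. f \<omega> - g \<omega>)"
  using sq_integrable_add[OF f sq_integrable_scaleR[OF g, of "-1"]] by simp

lemma integrable_inner_sq_integrable:
  fixes f g :: "'w \<Rightarrow> 'a::euclidean_space"
  assumes f: "sq_integrable M f" and g: "sq_integrable M g"
  shows "integrable M (\<lambda>\<omega>. f \<omega> \<bullet> g \<omega>)"
proof (rule Bochner_Integration.integrable_bound)
  note [measurable] = sq_integrable_measurable[OF f] sq_integrable_measurable[OF g]
  show "(\<lambda>\<omega>. f \<omega> \<bullet> g \<omega>) \<in> borel_measurable M" by measurable
  show "integrable M (\<lambda>\<omega>. (norm (f \<omega>))\<^sup>2 + (norm (g \<omega>))\<^sup>2)"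
    using sq_integrable_square[OF f] sq_integrable_square[OF g] by simp
  have "\<bar>a \<bullet> b\<bar> \<le> (norm a)\<^sup>2 + (norm b)\<^sup>2" for a b :: 'a
    using Cauchy_Schwarz_ineq2[of a b] sum_squares_bound[of "norm a" "norm b"]
      mult_nonneg_nonneg[OF norm_ge_zero norm_ge_zero, of a b] by linarith
  then show "AE \<omega> in M. norm (f \<omega> \<bullet> g \<omega>) \<le> norm ((norm (f \<omega>))\<^sup>2 + (norm (g \<omega>))\<^sup>2)" by simp
qed

lemma (in prob_space) sq_integrable_const: "sq_integrable M (\<lambda>_. c)"
  by (simp add: sq_integrable_def)

lemma (in prob_space) sq_integrable_imp_integrable:
  fixes f :: "'a \<Rightarrow> 'b::euclidean_space"
  assumes f: "sq_integrable M f"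
  shows "integrable M f"
proof (rule Bochner_Integration.integrable_bound)
  show "integrable M (\<lambda>\<omega>. (norm (f \<omega>))\<^sup>2 + 1)" using sq_integrable_square[OF f] by simp
  have "norm x \<le> (norm x)\<^sup>2 + 1" for x :: 'b
    using sum_squares_bound[of "norm x" 1] norm_ge_zero[of x] unfolding power_one mult_1_right by linarith
  then show "AE \<omega> in M. norm (f \<omega>) \<le> norm ((norm (f \<omega>))\<^sup>2 + 1)" by simp
qed (rule sq_integrable_measurable[OF f])

text \<open>By monotone convergence the sum of the nonnegative functions has a finite integral, so
  it is finite almost everywhere.\<close>

lemma AE_summable_of_summable_integral:
  fixes f :: "nat \<Rightarrow> 'w \<Rightarrow> real"
  assumes int: "\<And>k. integrable M (f k)" and 0: "\<And>k \<omega>. 0 \<le> f k \<omega>"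
    and sum: "summable (\<lambda>k. \<integral>\<omega>. f k \<omega> \<partial>M)"
  shows "AE \<omega> in M. summable (\<lambda>k. f k \<omega>)"
proof -
  have [measurable]: "f k \<in> borel_measurable M" for k using int by simp
  have "(\<integral>\<^sup>+\<omega>. (\<Sum>k. ennreal (f k \<omega>)) \<partial>M) = (\<Sum>k. \<integral>\<^sup>+\<omega>. ennreal (f k \<omega>) \<partial>M)"
    by (intro nn_integral_suminf) measurable
  also have "\<dots> = (\<Sum>k. ennreal (\<integral>\<omega>. f k \<omega> \<partial>M))"
    by (intro suminf_cong nn_integral_eq_integral int) (simp add: 0)
  also have "\<dots> = ennreal (\<Sum>k. \<integral>\<omega>. f k \<omega> \<partial>M)"
    by (intro suminf_ennreal2 sum integral_nonneg_AE) (simp add: 0)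
  finally have "(\<integral>\<^sup>+\<omega>. (\<Sum>k. ennreal (f k \<omega>)) \<partial>M) \<noteq> \<infinity>" by simp
  then have "AE \<omega> in M. (\<Sum>k. ennreal (f k \<omega>)) \<noteq> \<infinity>" by (intro nn_integral_PInf_AE) measurable
  then show ?thesis by eventually_elim (auto intro!: summable_suminf_not_top 0)
qed

section \<open>Norms and series of matrices by entries\<close>

lemma matrix_axis_expansion: "Z = (\<Sum>i\<in>UNIV. \<Sum>j\<in>UNIV. Z $ i $ j *\<^sub>R axis i (axis j 1))"
  for Z :: "real ^ 'n ^ 'm"
proof -
  have "(\<Sum>i\<in>UNIV. \<Sum>j\<in>UNIV. Z $ i $ j *\<^sub>R axis i (axis j 1)) $ a $ b = Z $ a $ b" for a b
  proof -
    have "(\<Sum>i\<in>UNIV. \<Sum>j\<in>UNIV. Z $ i $ j *\<^sub>R axis i (axis j 1)) $ a $ b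
       = (\<Sum>i\<in>UNIV. if i = a then (\<Sum>j\<in>UNIV. if j = b then Z $ i $ j else 0) else 0)"
      unfolding sum_component by (intro sum.cong refl) (auto simp: axis_def if_distrib[of "\<lambda>x. c * x" for c] cong: if_cong)
    also have "\<dots> = Z $ a $ b" by (simp add: sum.delta)
    finally show ?thesis .
  qed
  then show ?thesis by (simp add: vec_eq_iff)
qed

lemma norm_matrix_le_sum: "norm Z \<le> (\<Sum>i\<in>UNIV. \<Sum>j\<in>UNIV. \<bar>Z $ i $ j\<bar>)" for Z :: "real ^ 'n ^ 'm"
proof -
  have "norm (\<Sum>i\<in>UNIV. \<Sum>j\<in>UNIV. Z $ i $ j *\<^sub>R axis i (axis j 1) :: real ^ 'n ^ 'm) \<le> (\<Sum>i\<in>UNIV. \<Sum>j\<in>UNIV. \<bar>Z $ i $ j\<bar>)"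
    by (intro sum_norm_le) (simp add: norm_Basis axis_in_Basis_iff)
  then show ?thesis using matrix_axis_expansion[of Z] by simp
qed

lemma summable_matrix:
  fixes Z :: "nat \<Rightarrow> real ^ 'n ^ 'm"
  assumes "\<And>i j. summable (\<lambda>k. Z k $ i $ j)"
  shows "summable Z"
proof -
  have "summable (\<lambda>k. \<Sum>i\<in>UNIV. \<Sum>j\<in>UNIV. Z k $ i $ j *\<^sub>R (axis i (axis j 1) :: real ^ 'n ^ 'm))"
    by (intro summable_sum bounded_linear.summable[OF bounded_linear_scaleR_left] assms)
  then show ?thesis using matrix_axis_expansion[of "Z _"] by simp
qed

section \<open>Preconditioned stochastic gradient descent\<close>

text \<open>What the convergence argument retains of the method: \<open>H k\<close> stands for the
  damped curvature matrix, however it was computed, \<open>D\<close> for the gradient of the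
  objective, and \<open>L\<close> here for its Lipschitz constant. The strict inequality
  \<open>h1 < h2\<close> makes the descent constant \<open>\<rho>\<close> positive at the largest
  admissible step size.\<close>

locale preconditioned_sgd = prob_space M for M :: "'w measure" +
  fixes \<Psi> :: "real ^ 'n ^ 'm \<Rightarrow> real" and D :: "real ^ 'n ^ 'm \<Rightarrow> real ^ 'n ^ 'm"
    and \<Theta>0 :: "real ^ 'n ^ 'm" and \<Theta> G :: "nat \<Rightarrow> 'w \<Rightarrow> real ^ 'n ^ 'm"
    and H :: "nat \<Rightarrow> 'w \<Rightarrow> real ^ 'm ^ 'm"
    and \<alpha> \<sigma> :: "nat \<Rightarrow> real" and \<Psi>min L h1 h2 :: real
  assumes \<Theta>_meas[measurable]: "\<And>k. \<Theta> k \<in> borel_measurable M"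
    and G_meas[measurable]: "\<And>k. G k \<in> borel_measurable M"
    and H_meas[measurable]: "\<And>k. H k \<in> borel_measurable M"
    and start: "\<And>\<omega>. \<omega> \<in> space M \<Longrightarrow> \<Theta> 0 \<omega> = \<Theta>0"
    and step: "\<And>k \<omega>. \<omega> \<in> space M \<Longrightarrow> \<Theta> (Suc k) \<omega> = \<Theta> k \<omega> - \<alpha> k *\<^sub>R (matrix_inv (H k \<omega>) ** G k \<omega>)"
    and indep: "\<And>k. cond_indep_var M (history M \<Theta> k) (H k) (G k)"
    and gradient: "\<And>x. GDERIV \<Psi> x :> D x"
    and lower: "\<And>x. \<Psi>min \<le> \<Psi> x"
    and L_pos: "0 < L" and lipschitz: "\<And>x y. norm (D x - D y) \<le> L * norm (x - y)"
    and h1_pos: "0 < h1" and h1_h2: "h1 < h2"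
    and spectrum: "\<And>k. AE \<omega> in M. h1 *\<^sub>R mat 1 \<preceq>\<^sub>L H k \<omega> \<and> H k \<omega> \<preceq>\<^sub>L h2 *\<^sub>R mat 1"
    and unbiased: "\<And>k. AE \<omega> in M. mat_cond_exp M (history M \<Theta> k) (G k) \<omega> = D (\<Theta> k \<omega>)"
    and variance: "\<And>k. AE \<omega> in M. nn_cond_exp M (history M \<Theta> k)
          (\<lambda>\<omega>'. ennreal ((norm (G k \<omega>' - D (\<Theta> k \<omega>')))\<^sup>2)) \<omega> \<le> ennreal ((\<sigma> k)\<^sup>2)"
    and \<alpha>_pos: "\<And>k. 0 < \<alpha> k" and \<alpha>_le: "\<And>k. \<alpha> k \<le> 2 * h1\<^sup>2 / (L * h2)"
    and \<alpha>_div: "\<not> summable \<alpha>"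
    and noise: "summable (\<lambda>k. (\<alpha> k)\<^sup>2 * (\<sigma> k)\<^sup>2)"
begin

abbreviation "F \<equiv> history M \<Theta>"
abbreviation "P k \<omega> \<equiv> matrix_inv (H k \<omega>)"
abbreviation "g k \<omega> \<equiv> D (\<Theta> k \<omega>)"
abbreviation "X k \<omega> \<equiv> G k \<omega> - D (\<Theta> k \<omega>)"

section \<open>Measurability and second moments of gradients, noise and iterates\<close>

lemma subalg: "subalgebra M (F k)"
  by (intro subalgebra_history \<Theta>_meas)

lemma finite_subalg: "finite_measure_subalgebra M (F k)"
  by unfold_locales (rule subalg)

lemma F_imp_M: "f \<in> borel_measurable (F k) \<Longrightarrow> f \<in> borel_measurable M"
  using measurable_from_subalg[OF subalg] .

lemma D_borel[measurable]: "D \<in> borel_measurable borel"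
proof (intro borel_measurable_continuous_onI)
  have "L-lipschitz_on UNIV D" using lipschitz L_pos by (auto simp: lipschitz_on_def dist_norm)
  then show "continuous_on UNIV D" by (rule lipschitz_on_continuous_on)
qed

lemma \<Psi>_borel[measurable]: "\<Psi> \<in> borel_measurable borel"
proof (intro borel_measurable_continuous_onI continuous_at_imp_continuous_on ballI)
  fix x show "isCont \<Psi> x"
    using has_derivative_continuous[OF gradient[unfolded gderiv_def]] .
qed

lemma g_F: "g k \<in> borel_measurable (F k)"
  using measurable_history[of k k \<Theta> M] by measurable

text \<open>The conditional bound is stated for nonnegative functions, where conditional expectation
  presupposes no integrability; integrating it gives finiteness and the bound together.\<close>

lemma noise_sq_integrable: "sq_integrable M (X k)"
  and noise_second_moment: "(\<integral>\<omega>. (norm (X k \<omega>))\<^sup>2 \<partial>M) \<le> (\<sigma> k)\<^sup>2"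
proof -
  interpret F: finite_measure_subalgebra M "F k" by (rule finite_subalg)
  have "(\<integral>\<^sup>+\<omega>. ennreal ((norm (X k \<omega>))\<^sup>2) \<partial>M) = (\<integral>\<^sup>+\<omega>. nn_cond_exp M (F k) (\<lambda>\<omega>'. ennreal ((norm (X k \<omega>'))\<^sup>2)) \<omega> \<partial>M)"
    using F.nn_cond_exp_intg[of "\<lambda>_. 1" "\<lambda>\<omega>'. ennreal ((norm (X k \<omega>'))\<^sup>2)"] by simp
  also have "\<dots> \<le> (\<integral>\<^sup>+\<omega>. ennreal ((\<sigma> k)\<^sup>2) \<partial>M)" by (intro nn_integral_mono_AE variance)
  also have "\<dots> = ennreal ((\<sigma> k)\<^sup>2)" by (simp add: emeasure_space_1)
  finally have le: "(\<integral>\<^sup>+\<omega>. ennreal ((norm (X k \<omega>))\<^sup>2) \<partial>M) \<le> ennreal ((\<sigma> k)\<^sup>2)" .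
  have int: "integrable M (\<lambda>\<omega>. (norm (X k \<omega>))\<^sup>2)"
    by (intro integrableI_bounded) (use le in \<open>auto intro: le_less_trans\<close>)
  then show "sq_integrable M (X k)" by (simp add: sq_integrable_def)
  show "(\<integral>\<omega>. (norm (X k \<omega>))\<^sup>2 \<partial>M) \<le> (\<sigma> k)\<^sup>2"
    using le by (subst (asm) nn_integral_eq_integral[OF int]) auto
qed

text \<open>The quantifier over \<open>Z\<close> stands inside the almost sure statement, so that
  the random matrices \<open>g k \<omega>\<close> and \<open>X k \<omega>\<close> may be inserted
  for \<open>Z\<close>.\<close>

lemma P_bounds:
  "AE \<omega> in M. \<forall>Z :: real ^ 'n ^ 'm. h1 * (norm (P k \<omega> ** Z))\<^sup>2 \<le> Z \<bullet> (P k \<omega> ** Z)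
     \<and> (norm Z)\<^sup>2 / h2 \<le> Z \<bullet> (P k \<omega> ** Z) \<and> norm (P k \<omega> ** Z) \<le> norm Z / h1"
  using spectrum[of k]
proof eventually_elim
  case (elim \<omega>)
  then show ?case using matrix_inv_loewner_mult[of h1 "H k \<omega>" h2] h1_pos h1_h2 by auto
qed

text \<open>The norm bound for \<open>P k \<omega> ** Z\<close> at the identity matrix. Bounded
  entries are the condition under which \<open>noise_orthogonal\<close> accepts a function of
  \<open>H k\<close>.\<close>

lemma P_entry_bound:
  "AE \<omega> in M. \<forall>i l. \<bar>P k \<omega> $ i $ l\<bar> \<le> norm (mat 1 :: real ^ 'm ^ 'm) / h1"
  using spectrum[of k]
proof eventually_elim
  case (elim \<omega>)
  have "norm (P k \<omega>) \<le> norm (mat 1 :: real ^ 'm ^ 'm) / h1"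
    using matrix_inv_loewner_mult(3)[of h1 "H k \<omega>" h2 "mat 1"] elim h1_pos h1_h2 by simp
  then show ?case using norm_matrix_nth_le order_trans by blast
qed

lemma P_mult_sq_integrable:
  assumes "sq_integrable M Z"
  shows "sq_integrable M (\<lambda>\<omega>. P k \<omega> ** (Z \<omega> :: real ^ 'n ^ 'm))"
proof (rule sq_integrable_bound[OF assms, where C = "1 / h1"])
  have [measurable]: "Z \<in> borel_measurable M" using assms by (rule sq_integrable_measurable)
  show "(\<lambda>\<omega>. P k \<omega> ** Z \<omega>) \<in> borel_measurable M" by measurable
  show "AE \<omega> in M. norm (P k \<omega> ** Z \<omega>) \<le> 1 / h1 * norm (Z \<omega>)"
    using P_bounds[of k] by eventually_elim simp
qed

lemma D_comp_sq_integrable: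
  assumes "sq_integrable M Z"
  shows "sq_integrable M (\<lambda>\<omega>. D (Z \<omega>))"
proof -
  have [measurable]: "Z \<in> borel_measurable M" using assms by (rule sq_integrable_measurable)
  have "sq_integrable M (\<lambda>\<omega>. D (Z \<omega>) - D 0)"
    by (rule sq_integrable_bound[OF assms, where C = L]) (use lipschitz[of _ 0] in auto)
  from sq_integrable_add[OF this sq_integrable_const[of "D 0"]] show ?thesis by simp
qed

text \<open>The start is deterministic, and \<open>G k\<close> is the sum of \<open>g k\<close>,
  which grows at most linearly in \<open>\<Theta> k\<close>, and the square integrable noise;
  \<open>P k\<close> is bounded.\<close>

lemma \<Theta>_sq_integrable: "sq_integrable M (\<Theta> k)"
proof (induction k)
  case 0
  show ?case
    by (rule sq_integrable_bound[OF sq_integrable_const[of \<Theta>0], where C = 1]) (use start in auto)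
next
  case (Suc k)
  have "sq_integrable M (\<lambda>\<omega>. g k \<omega> + X k \<omega>)"
    by (intro sq_integrable_add D_comp_sq_integrable Suc noise_sq_integrable)
  then have "sq_integrable M (\<lambda>\<omega>. \<Theta> k \<omega> - \<alpha> k *\<^sub>R (P k \<omega> ** G k \<omega>))"
    by (intro sq_integrable_diff Suc sq_integrable_scaleR P_mult_sq_integrable) simp
  then show ?case
    by (rule sq_integrable_bound[where C = 1]) (use step in auto)
qed

lemma g_sq_integrable: "sq_integrable M (g k)"
  by (intro D_comp_sq_integrable \<Theta>_sq_integrable)

lemma G_sq_integrable: "sq_integrable M (G k)"
  using sq_integrable_add[OF g_sq_integrable[of k] noise_sq_integrable[of k]] by simp

section \<open>Orthogonality of the noise\<close>

lemma nth_sq_integrable: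
  fixes Z :: "'w \<Rightarrow> real ^ 'q ^ 'p"
  assumes "sq_integrable M Z"
  shows "sq_integrable M (\<lambda>\<omega>. Z \<omega> $ i $ j)"
proof (rule sq_integrable_bound[OF assms, where C = 1])
  have [measurable]: "Z \<in> borel_measurable M" using assms by (rule sq_integrable_measurable)
  show "(\<lambda>\<omega>. Z \<omega> $ i $ j) \<in> borel_measurable M" by measurable
  show "AE \<omega> in M. norm (Z \<omega> $ i $ j) \<le> 1 * norm (Z \<omega>)" using norm_matrix_nth_le by auto
qed

text \<open>The inner product is a finite sum of entry products, each an instance of
  \<open>cond_indep_var_centered\<close> with an entry of \<open>\<phi>\<close> applied to
  \<open>H k\<close> and an entry of \<open>G k\<close> centred at that of the gradient. A general
  \<open>\<phi>\<close> covers both \<open>matrix_inv\<close> and the product of its transpose with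
  it.\<close>

lemma noise_orthogonal:
  assumes \<phi>[measurable]: "\<phi> \<in> borel_measurable borel"
    and bound: "AE \<omega> in M. \<forall>i l. \<bar>\<phi> (H k \<omega>) $ i $ l\<bar> \<le> C"
    and Y: "Y \<in> borel_measurable (F k)" and Y2: "sq_integrable M Y"
  shows "(\<integral>\<omega>. Y \<omega> \<bullet> (\<phi> (H k \<omega>) ** X k \<omega>) \<partial>M) = 0"
proof -
  have [measurable]: "Y \<in> borel_measurable M" using Y by (rule F_imp_M)
  have entry: "integrable M (\<lambda>\<omega>. \<phi> (H k \<omega>) $ i $ l * (Y \<omega> $ i $ j * X k \<omega> $ l $ j))
      \<and> (\<integral>\<omega>. \<phi> (H k \<omega>) $ i $ l * (Y \<omega> $ i $ j * X k \<omega> $ l $ j) \<partial>M) = 0" for i j l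
  proof -
    have iYX: "integrable M (\<lambda>\<omega>. Y \<omega> $ i $ j * X k \<omega> $ l $ j)"
      using integrable_inner_sq_integrable[OF nth_sq_integrable[OF Y2] nth_sq_integrable[OF noise_sq_integrable], of i j k l j]
      by simp
    have i: "integrable M (\<lambda>\<omega>. \<phi> (H k \<omega>) $ i $ l * (Y \<omega> $ i $ j * X k \<omega> $ l $ j))"
    proof (rule Bochner_Integration.integrable_bound)
      show "integrable M (\<lambda>\<omega>. C * (Y \<omega> $ i $ j * X k \<omega> $ l $ j))" using iYX by simp
      show "AE \<omega> in M. norm (\<phi> (H k \<omega>) $ i $ l * (Y \<omega> $ i $ j * X k \<omega> $ l $ j)) \<le> norm (C * (Y \<omega> $ i $ j * X k \<omega> $ l $ j))"
        using bound
      proof eventually_elim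
        case (elim \<omega>)
        then have "\<bar>\<phi> (H k \<omega>) $ i $ l\<bar> \<le> \<bar>C\<bar>" by (meson abs_ge_self order_trans)
        then show ?case unfolding real_norm_def abs_mult by (intro mult_right_mono) auto
      qed
    qed measurable
    have "(\<integral>\<omega>. (\<lambda>A. \<phi> A $ i $ l) (H k \<omega>) * (Y \<omega> $ i $ j * ((\<lambda>Z. Z $ l $ j) (G k \<omega>) - g k \<omega> $ l $ j)) \<partial>M) = 0"
    proof (rule cond_indep_var_centered[OF prob_space_axioms subalg[of k] indep[of k]])
      show "integrable M (\<lambda>\<omega>. G k \<omega> $ l $ j)" "integrable M (\<lambda>\<omega>. g k \<omega> $ l $ j)"
        by (intro sq_integrable_imp_integrable nth_sq_integrable G_sq_integrable g_sq_integrable)+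
      show "(\<lambda>\<omega>. g k \<omega> $ l $ j) \<in> borel_measurable (F k)" using g_F[of k] by measurable
      show "(\<lambda>\<omega>. Y \<omega> $ i $ j) \<in> borel_measurable (F k)" using Y by measurable
      show "AE \<omega> in M. real_cond_exp M (F k) (\<lambda>\<omega>. G k \<omega> $ l $ j) \<omega> = g k \<omega> $ l $ j"
        using unbiased[of k]
      proof eventually_elim
        case (elim \<omega>)
        have "mat_cond_exp M (F k) (G k) \<omega> $ l $ j = real_cond_exp M (F k) (\<lambda>\<omega>. G k \<omega> $ l $ j) \<omega>"
          by (simp add: mat_cond_exp_def)
        then show ?case using elim by simp
      qed
      show "integrable M (\<lambda>\<omega>. Y \<omega> $ i $ j * (G k \<omega> $ l $ j - g k \<omega> $ l $ j))" using iYX by simp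
      show "integrable M (\<lambda>\<omega>. \<phi> (H k \<omega>) $ i $ l * (Y \<omega> $ i $ j * (G k \<omega> $ l $ j - g k \<omega> $ l $ j)))" using i by simp
    qed measurable
    then show ?thesis using i by simp
  qed
  have "Y \<omega> \<bullet> (\<phi> (H k \<omega>) ** X k \<omega>) = (\<Sum>i\<in>UNIV. \<Sum>j\<in>UNIV. \<Sum>l\<in>UNIV. \<phi> (H k \<omega>) $ i $ l * (Y \<omega> $ i $ j * X k \<omega> $ l $ j))" for \<omega>
    by (simp add: inner_vec_def matrix_matrix_mult_def sum_distrib_left mult_ac)
  then show ?thesis using entry by (simp add: Bochner_Integration.integral_sum)
qed

lemma preconditioned_noise_orthogonal:
  assumes "Y \<in> borel_measurable (F k)" "sq_integrable M Y"
  shows "(\<integral>\<omega>. Y \<omega> \<bullet> (P k \<omega> ** X k \<omega>) \<partial>M) = 0"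
  by (rule noise_orthogonal[OF _ P_entry_bound assms]) measurable

text \<open>\<open>P k ** g k\<close> depends on \<open>H k\<close> and need not be a function of
  the past iterates. Moving its factor \<open>P k\<close> to the other side leaves
  \<open>g k\<close> against \<open>transpose (P k) ** P k\<close> applied to the noise, and that
  product is again a function of \<open>H k\<close>.\<close>

lemma preconditioned_gradient_noise_orthogonal:
  "(\<integral>\<omega>. (P k \<omega> ** g k \<omega>) \<bullet> (P k \<omega> ** X k \<omega>) \<partial>M) = 0"
proof -
  define c where "c = norm (mat 1 :: real ^ 'm ^ 'm) / h1"
  have c0: "0 \<le> c" using h1_pos by (simp add: c_def)
  \<comment> \<open>Each entry of the product is a sum of \<open>CARD('m)\<close> terms, each at
    most \<open>c * c\<close>.\<close>
  have b: "AE \<omega> in M. \<forall>i l. \<bar>(transpose (P k \<omega>) ** P k \<omega>) $ i $ l\<bar> \<le> (\<Sum>q\<in>(UNIV :: 'm set). c * c)"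
    using P_entry_bound[of k]
  proof eventually_elim
    case (elim \<omega>)
    then show ?case using c0
      by (auto simp: matrix_matrix_mult_def transpose_def c_def[symmetric] abs_mult
          intro!: order_trans[OF sum_abs] sum_bounded_above[THEN order_trans] mult_mono)
  qed
  have "(\<integral>\<omega>. g k \<omega> \<bullet> ((transpose (P k \<omega>) ** P k \<omega>) ** X k \<omega>) \<partial>M) = 0"
    by (rule noise_orthogonal[of "\<lambda>A. transpose (matrix_inv A) ** matrix_inv A", OF _ b g_F g_sq_integrable]) measurable
  moreover have "g k \<omega> \<bullet> ((transpose (P k \<omega>) ** P k \<omega>) ** X k \<omega>) = (P k \<omega> ** g k \<omega>) \<bullet> (P k \<omega> ** X k \<omega>)" for \<omega>
    by (simp add: inner_matrix_mult_transpose matrix_mul_assoc[symmetric])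
  ultimately show ?thesis by simp
qed

section \<open>Descent in expectation\<close>

lemma \<Psi>_upper: "\<Psi> (x + v) \<le> \<Psi> x + D x \<bullet> v + L / 2 * (norm v)\<^sup>2"
  by (rule lipschitz_gradient_descent[OF gradient lipschitz])

text \<open>\<open>\<Psi>\<close> lies between the constant \<open>\<Psi>min\<close> and the
  quadratic model around \<open>\<Theta>0\<close>, and the latter is integrable along square
  integrable iterates.\<close>

lemma \<Psi>_integrable: "integrable M (\<lambda>\<omega>. \<Psi> (\<Theta> k \<omega>))"
proof (rule Bochner_Integration.integrable_bound)
  let ?v = "\<lambda>\<omega>. \<Theta> k \<omega> - \<Theta>0"
  have v: "sq_integrable M ?v" by (intro sq_integrable_diff \<Theta>_sq_integrable sq_integrable_const)
  show "integrable M (\<lambda>\<omega>. \<bar>\<Psi>min\<bar> + \<bar>\<Psi> \<Theta>0 + D \<Theta>0 \<bullet> ?v \<omega> + L / 2 * (norm (?v \<omega>))\<^sup>2\<bar>)"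
    using integrable_inner_sq_integrable[OF sq_integrable_const[of "D \<Theta>0"] v] sq_integrable_square[OF v]
    by (intro Bochner_Integration.integrable_add integrable_abs) auto
  have "\<bar>\<Psi> (\<Theta> k \<omega>)\<bar> \<le> \<bar>\<bar>\<Psi>min\<bar> + \<bar>\<Psi> \<Theta>0 + D \<Theta>0 \<bullet> ?v \<omega> + L / 2 * (norm (?v \<omega>))\<^sup>2\<bar>\<bar>" for \<omega>
    using \<Psi>_upper[of \<Theta>0 "?v \<omega>"] lower[of "\<Theta> k \<omega>"] by simp
  then show "AE \<omega> in M. norm (\<Psi> (\<Theta> k \<omega>)) \<le> norm (\<bar>\<Psi>min\<bar> + \<bar>\<Psi> \<Theta>0 + D \<Theta>0 \<bullet> ?v \<omega> + L / 2 * (norm (?v \<omega>))\<^sup>2\<bar>)" by simp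
qed measurable

text \<open>The quadratic term consumes at most the fraction \<open>h1 / h2\<close> of the
  first-order decrease, which is itself at least \<open>\<alpha> k / h2\<close> times the squared
  gradient norm.\<close>

definition "\<rho> = (1 - h1 / h2) / h2"

lemma \<rho>_pos: "0 < \<rho>" using h1_pos h1_h2 by (simp add: \<rho>_def)

text \<open>Splitting \<open>P k ** G k\<close> into gradient and noise parts, the quadratic upper
  bound yields two terms linear in the noise, which integrate to 0 by orthogonality, and two pure
  squares. The gradient square is absorbed by the decrease, the noise square is paid for by the
  variance.\<close>

lemma expected_descent:
  "(\<integral>\<omega>. \<Psi> (\<Theta> (Suc k) \<omega>) \<partial>M) + \<rho> * (\<alpha> k * (\<integral>\<omega>. (norm (g k \<omega>))\<^sup>2 \<partial>M))
    \<le> (\<integral>\<omega>. \<Psi> (\<Theta> k \<omega>) \<partial>M) + L / (2 * h1\<^sup>2) * ((\<alpha> k)\<^sup>2 * (\<sigma> k)\<^sup>2)"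
proof -
  let ?a = "\<alpha> k"
  let ?Pg = "\<lambda>\<omega>. P k \<omega> ** g k \<omega>" and ?PX = "\<lambda>\<omega>. P k \<omega> ** X k \<omega>"
  have a: "0 < ?a" by (rule \<alpha>_pos)
  have La: "L * ?a / (2 * h1) \<le> h1 / h2"
  proof -
    have "L * ?a \<le> L * (2 * h1\<^sup>2 / (L * h2))" using L_pos by (intro mult_left_mono \<alpha>_le) auto
    also have "\<dots> = 2 * h1 * (h1 / h2)" using L_pos by (simp add: power2_eq_square)
    finally show ?thesis using h1_pos by (simp add: field_simps)
  qed
  \<comment> \<open>The two terms linear in the noise are kept on the left, since they vanish only
    after integration.\<close>
  have pt: "AE \<omega> in M. \<Psi> (\<Theta> (Suc k) \<omega>) + \<rho> * (?a * (norm (g k \<omega>))\<^sup>2)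
      + (?a * (g k \<omega> \<bullet> ?PX \<omega>) - L * ?a\<^sup>2 * (?Pg \<omega> \<bullet> ?PX \<omega>))
      \<le> \<Psi> (\<Theta> k \<omega>) + L / (2 * h1\<^sup>2) * (?a\<^sup>2 * (norm (X k \<omega>))\<^sup>2)"
    using P_bounds[of k] AE_space
  proof eventually_elim
    case (elim \<omega>)
    let ?g = "g k \<omega>" and ?x = "X k \<omega>" and ?p = "?Pg \<omega>" and ?q = "?PX \<omega>"
    have PG: "P k \<omega> ** G k \<omega> = ?p + ?q" by (simp flip: matrix_add_ldistrib)
    have sq: "(norm (?p + ?q))\<^sup>2 = (norm ?p)\<^sup>2 + 2 * (?p \<bullet> ?q) + (norm ?q)\<^sup>2"
      by (simp add: power2_norm_eq_inner inner_add_left inner_add_right inner_commute)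
    have "\<Psi> (\<Theta> (Suc k) \<omega>) = \<Psi> (\<Theta> k \<omega> + (- ?a) *\<^sub>R (?p + ?q))" using step[OF elim(2)] PG by simp
    also have "\<dots> \<le> \<Psi> (\<Theta> k \<omega>) + ?g \<bullet> ((- ?a) *\<^sub>R (?p + ?q)) + L / 2 * (norm ((- ?a) *\<^sub>R (?p + ?q)))\<^sup>2"
      by (rule \<Psi>_upper)
    also have "\<dots> = \<Psi> (\<Theta> k \<omega>) - ?a * (?g \<bullet> ?p) - ?a * (?g \<bullet> ?q)
        + L / 2 * ?a\<^sup>2 * (norm ?p)\<^sup>2 + L * ?a\<^sup>2 * (?p \<bullet> ?q) + L / 2 * ?a\<^sup>2 * (norm ?q)\<^sup>2"
      unfolding norm_scaleR power_mult_distrib sq by (simp add: inner_add_right inner_diff_right algebra_simps)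
    finally have 1: "\<Psi> (\<Theta> (Suc k) \<omega>) \<le> \<Psi> (\<Theta> k \<omega>) - ?a * (?g \<bullet> ?p) - ?a * (?g \<bullet> ?q)
        + L / 2 * ?a\<^sup>2 * (norm ?p)\<^sup>2 + L * ?a\<^sup>2 * (?p \<bullet> ?q) + L / 2 * ?a\<^sup>2 * (norm ?q)\<^sup>2" .
    have gp: "(norm ?g)\<^sup>2 / h2 \<le> ?g \<bullet> ?p" "h1 * (norm ?p)\<^sup>2 \<le> ?g \<bullet> ?p" using elim(1) by auto
    have gp0: "0 \<le> ?g \<bullet> ?p" using gp(1) h1_pos h1_h2 by (meson divide_nonneg_pos less_trans order_trans zero_le_power2)
    \<comment> \<open>The factor \<open>h1\<close> is split off so that the bound of
      \<open>h1 * (norm ?p)\<^sup>2\<close> by \<open>?g \<bullet> ?p\<close> applies; the rest is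
      the quantity in \<open>La\<close>, which the step size condition bounds.\<close>
    have "L / 2 * ?a\<^sup>2 * (norm ?p)\<^sup>2 = (L * ?a / (2 * h1)) * (?a * (h1 * (norm ?p)\<^sup>2))"
      using h1_pos by (simp add: power2_eq_square)
    also have "\<dots> \<le> (h1 / h2) * (?a * (?g \<bullet> ?p))"
      using La a gp gp0 h1_pos h1_h2 by (intro mult_mono) auto
    finally have 2: "L / 2 * ?a\<^sup>2 * (norm ?p)\<^sup>2 \<le> (h1 / h2) * (?a * (?g \<bullet> ?p))" .
    have "\<rho> * (?a * (norm ?g)\<^sup>2) = (1 - h1 / h2) * (?a * ((norm ?g)\<^sup>2 / h2))" by (simp add: \<rho>_def)
    also have "\<dots> \<le> (1 - h1 / h2) * (?a * (?g \<bullet> ?p))"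
      using gp a h1_pos h1_h2 by (intro mult_left_mono) auto
    finally have 3: "\<rho> * (?a * (norm ?g)\<^sup>2) \<le> ?a * (?g \<bullet> ?p) - (h1 / h2) * (?a * (?g \<bullet> ?p))"
      by (simp add: left_diff_distrib)
    have "(norm ?q)\<^sup>2 \<le> (norm ?x / h1)\<^sup>2" using elim(1) by (intro power_mono) auto
    then have "L / 2 * ?a\<^sup>2 * (norm ?q)\<^sup>2 \<le> L / 2 * ?a\<^sup>2 * (norm ?x / h1)\<^sup>2"
      using L_pos by (intro mult_left_mono) auto
    then have 4: "L / 2 * ?a\<^sup>2 * (norm ?q)\<^sup>2 \<le> L / (2 * h1\<^sup>2) * (?a\<^sup>2 * (norm ?x)\<^sup>2)"
      by (simp add: power_divide)
    show ?case using 1 2 3 4 by linarith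
  qed
  have i1: "integrable M (\<lambda>\<omega>. (norm (g k \<omega>))\<^sup>2)" by (intro sq_integrable_square g_sq_integrable)
  have i2: "integrable M (\<lambda>\<omega>. (norm (X k \<omega>))\<^sup>2)" by (intro sq_integrable_square noise_sq_integrable)
  have i3: "integrable M (\<lambda>\<omega>. g k \<omega> \<bullet> ?PX \<omega>)"
    by (intro integrable_inner_sq_integrable P_mult_sq_integrable g_sq_integrable noise_sq_integrable)
  have i4: "integrable M (\<lambda>\<omega>. ?Pg \<omega> \<bullet> ?PX \<omega>)"
    by (intro integrable_inner_sq_integrable P_mult_sq_integrable g_sq_integrable noise_sq_integrable)
  have "(\<integral>\<omega>. \<Psi> (\<Theta> (Suc k) \<omega>) \<partial>M) + \<rho> * (?a * (\<integral>\<omega>. (norm (g k \<omega>))\<^sup>2 \<partial>M))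
      = (\<integral>\<omega>. \<Psi> (\<Theta> (Suc k) \<omega>) + \<rho> * (?a * (norm (g k \<omega>))\<^sup>2)
          + (?a * (g k \<omega> \<bullet> ?PX \<omega>) - L * ?a\<^sup>2 * (?Pg \<omega> \<bullet> ?PX \<omega>)) \<partial>M)"
    using i1 i3 i4 \<Psi>_integrable[of "Suc k"] preconditioned_noise_orthogonal[OF g_F g_sq_integrable]
      preconditioned_gradient_noise_orthogonal[of k] by simp
  also have "\<dots> \<le> (\<integral>\<omega>. \<Psi> (\<Theta> k \<omega>) + L / (2 * h1\<^sup>2) * (?a\<^sup>2 * (norm (X k \<omega>))\<^sup>2) \<partial>M)"
    by (rule integral_mono_AE[OF _ _ pt])
      (intro Bochner_Integration.integrable_add Bochner_Integration.integrable_diff integrable_mult_right i1 i2 i3 i4 \<Psi>_integrable)+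
  also have "\<dots> = (\<integral>\<omega>. \<Psi> (\<Theta> k \<omega>) \<partial>M) + L / (2 * h1\<^sup>2) * (?a\<^sup>2 * (\<integral>\<omega>. (norm (X k \<omega>))\<^sup>2 \<partial>M))"
    using i2 \<Psi>_integrable[of k] by simp
  also have "\<dots> \<le> (\<integral>\<omega>. \<Psi> (\<Theta> k \<omega>) \<partial>M) + L / (2 * h1\<^sup>2) * (?a\<^sup>2 * (\<sigma> k)\<^sup>2)"
    using L_pos by (intro add_left_mono mult_left_mono noise_second_moment) auto
  finally show ?thesis .
qed

text \<open>The descent inequality telescopes; the total decrease is limited by
  \<open>\<Psi>min\<close> and the total noise by the convergent series.\<close>

lemma summable_expected_gradient: "summable (\<lambda>k. \<alpha> k * (\<integral>\<omega>. (norm (g k \<omega>))\<^sup>2 \<partial>M))"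
proof -
  define c where "c = L / (2 * h1\<^sup>2)"
  define E where "E k = (\<integral>\<omega>. (norm (g k \<omega>))\<^sup>2 \<partial>M)" for k
  have c0: "0 \<le> c" using L_pos by (simp add: c_def)
  have E0: "0 \<le> E k" for k by (simp add: E_def)
  have tele: "(\<integral>\<omega>. \<Psi> (\<Theta> K \<omega>) \<partial>M) + \<rho> * (\<Sum>k<K. \<alpha> k * E k)
      \<le> (\<integral>\<omega>. \<Psi> (\<Theta> 0 \<omega>) \<partial>M) + c * (\<Sum>k<K. (\<alpha> k)\<^sup>2 * (\<sigma> k)\<^sup>2)" for K
  proof (induction K)
    case (Suc K)
    then show ?case using expected_descent[of K] by (simp add: E_def[symmetric] c_def[symmetric] distrib_left)
  qed simp
  have min: "\<Psi>min \<le> (\<integral>\<omega>. \<Psi> (\<Theta> K \<omega>) \<partial>M)" for K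
    by (rule integral_ge_const[OF \<Psi>_integrable]) (simp add: lower)
  have total: "c * (\<Sum>k<K. (\<alpha> k)\<^sup>2 * (\<sigma> k)\<^sup>2) \<le> c * (\<Sum>k. (\<alpha> k)\<^sup>2 * (\<sigma> k)\<^sup>2)" for K
    by (intro mult_left_mono sum_le_suminf noise c0) auto
  have "\<rho> * (\<Sum>k<K. \<alpha> k * E k) \<le> (\<integral>\<omega>. \<Psi> (\<Theta> 0 \<omega>) \<partial>M) + c * (\<Sum>k. (\<alpha> k)\<^sup>2 * (\<sigma> k)\<^sup>2) - \<Psi>min" for K
    using tele[of K] min[of K] total[of K] by linarith
  then have "(\<Sum>k<K. \<alpha> k * E k) \<le> ((\<integral>\<omega>. \<Psi> (\<Theta> 0 \<omega>) \<partial>M) + c * (\<Sum>k. (\<alpha> k)\<^sup>2 * (\<sigma> k)\<^sup>2) - \<Psi>min) / \<rho>" for K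
    using \<rho>_pos by (simp add: field_simps)
  then show ?thesis unfolding E_def[symmetric]
    by (intro summableI_nonneg_bounded) (use \<alpha>_pos E0 in \<open>auto intro: mult_nonneg_nonneg less_imp_le\<close>)
qed

lemma AE_summable_gradient: "AE \<omega> in M. summable (\<lambda>k. \<alpha> k * (norm (g k \<omega>))\<^sup>2)"
proof (rule AE_summable_of_summable_integral)
  show "integrable M (\<lambda>\<omega>. \<alpha> k * (norm (g k \<omega>))\<^sup>2)" for k
    using sq_integrable_square[OF g_sq_integrable] by simp
  show "0 \<le> \<alpha> k * (norm (g k \<omega>))\<^sup>2" for k \<omega> using \<alpha>_pos[of k] by simp
  show "summable (\<lambda>k. \<integral>\<omega>. \<alpha> k * (norm (g k \<omega>))\<^sup>2 \<partial>M)"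
    using summable_expected_gradient by simp
qed

section \<open>Drift and martingale part of the increments\<close>

definition "\<Delta> i j k \<omega> = (\<Theta> (Suc k) \<omega> - \<Theta> k \<omega>) $ i $ j"
text \<open>Doob decomposition of the increment: conditioning the increment itself makes
  \<open>mart i j k\<close> a function of iterates up to \<open>Suc k\<close>, hence adapted, which
  the noise multiplied by \<open>P k\<close> need not be.\<close>

definition "drift i j k = real_cond_exp M (F k) (\<Delta> i j k)"
definition "mart i j k \<omega> = \<Delta> i j k \<omega> - drift i j k \<omega>"

lemma \<Delta>_sq_integrable: "sq_integrable M (\<Delta> i j k)"
  unfolding \<Delta>_def by (intro nth_sq_integrable sq_integrable_diff \<Theta>_sq_integrable)

lemma \<Delta>_integrable: "integrable M (\<Delta> i j k)"
  by (intro sq_integrable_imp_integrable \<Delta>_sq_integrable)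

text \<open>The increment is \<open>u - w\<close>. The noise part \<open>w\<close> has conditional
  mean 0, and \<open>u\<close> lies between \<open>- b\<close> and \<open>b\<close>, where
  \<open>b\<close> depends only on the past iterates and is therefore its own conditional
  expectation.\<close>

lemma drift_bound: "AE \<omega> in M. \<bar>drift i j k \<omega>\<bar> \<le> \<alpha> k / h1 * norm (g k \<omega>)"
proof -
  interpret F: finite_measure_subalgebra M "F k" by (rule finite_subalg)
  define u where "u \<omega> = - \<alpha> k * (P k \<omega> ** g k \<omega>) $ i $ j" for \<omega>
  define w where "w \<omega> = \<alpha> k * (P k \<omega> ** X k \<omega>) $ i $ j" for \<omega>
  define b where "b \<omega> = \<alpha> k / h1 * norm (g k \<omega>)" for \<omega>
  have iu: "integrable M u" unfolding u_def
    by (intro integrable_mult_right sq_integrable_imp_integrable nth_sq_integrable P_mult_sq_integrable g_sq_integrable)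
  have iw: "integrable M w" unfolding w_def
    by (intro integrable_mult_right sq_integrable_imp_integrable nth_sq_integrable P_mult_sq_integrable noise_sq_integrable)
  have ib: "integrable M b" unfolding b_def
    by (intro integrable_mult_right integrable_norm sq_integrable_imp_integrable g_sq_integrable)
  have bF: "b \<in> borel_measurable (F k)" unfolding b_def using g_F[of k] by measurable
  have \<Delta>M[measurable]: "\<Delta> i j k \<in> borel_measurable M" using \<Delta>_integrable by simp
  have eq: "AE \<omega> in M. \<Delta> i j k \<omega> = u \<omega> - w \<omega>"
  proof (rule AE_I2)
    fix \<omega> assume "\<omega> \<in> space M"
    moreover have "P k \<omega> ** G k \<omega> = P k \<omega> ** g k \<omega> + P k \<omega> ** X k \<omega>" by (simp flip: matrix_add_ldistrib)
    ultimately show "\<Delta> i j k \<omega> = u \<omega> - w \<omega>"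
      by (simp add: \<Delta>_def step u_def w_def algebra_simps)
  qed
  have "AE \<omega> in M. real_cond_exp M (F k) w \<omega> = 0"
  proof (rule F.real_cond_exp_charact)
    fix A assume A: "A \<in> sets (F k)"
    \<comment> \<open>A matrix unit, restricted to \<open>A\<close>, selects one entry of the
      preconditioned noise, so that orthogonality says that \<open>w\<close> integrates to 0 over
      \<open>A\<close>.\<close>
    define Y :: "'w \<Rightarrow> real ^ 'n ^ 'm" where "Y \<omega> = (\<alpha> k * indicator A \<omega>) *\<^sub>R axis i (axis j 1)" for \<omega>
    have YF: "Y \<in> borel_measurable (F k)" unfolding Y_def using A by measurable
    have Y2: "sq_integrable M Y"
      by (rule sq_integrable_bound[OF sq_integrable_const[of "\<alpha> k"], where C = 1])
        (use F_imp_M[OF YF] in \<open>auto simp: Y_def indicator_def norm_Basis\<close>)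
    have "Y \<omega> \<bullet> (P k \<omega> ** X k \<omega>) = indicator A \<omega> * w \<omega>" for \<omega>
      by (simp add: Y_def w_def inner_axis' mult_ac)
    then show "(\<integral>\<omega>\<in>A. w \<omega> \<partial>M) = (\<integral>\<omega>\<in>A. 0 \<partial>M)"
      using preconditioned_noise_orthogonal[OF YF Y2] by (simp add: set_lebesgue_integral_def)
  qed (use iw in auto)
  moreover have "AE \<omega> in M. drift i j k \<omega> = real_cond_exp M (F k) (\<lambda>\<omega>. u \<omega> - w \<omega>) \<omega>"
    unfolding drift_def by (rule F.real_cond_exp_cong[OF eq]) (use iu iw in auto)
  moreover have "AE \<omega> in M. real_cond_exp M (F k) (\<lambda>\<omega>. u \<omega> - w \<omega>) \<omega> = real_cond_exp M (F k) u \<omega> - real_cond_exp M (F k) w \<omega>"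
    by (rule F.real_cond_exp_diff[OF iu iw])
  moreover have ub: "AE \<omega> in M. \<bar>u \<omega>\<bar> \<le> b \<omega>"
    using P_bounds[of k]
  proof eventually_elim
    case (elim \<omega>)
    have "\<bar>(P k \<omega> ** g k \<omega>) $ i $ j\<bar> \<le> norm (g k \<omega>) / h1" using elim norm_matrix_nth_le order_trans by blast
    then have "\<alpha> k * \<bar>(P k \<omega> ** g k \<omega>) $ i $ j\<bar> \<le> \<alpha> k * (norm (g k \<omega>) / h1)"
      using \<alpha>_pos[of k] by (intro mult_left_mono) auto
    then show ?case using \<alpha>_pos[of k] by (simp add: u_def b_def abs_mult)
  qed
  moreover have "AE \<omega> in M. real_cond_exp M (F k) u \<omega> \<le> real_cond_exp M (F k) b \<omega>"
    by (rule F.real_cond_exp_mono[OF _ iu ib]) (use ub in eventually_elim, auto)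
  moreover have "AE \<omega> in M. real_cond_exp M (F k) (\<lambda>\<omega>. - b \<omega>) \<omega> \<le> real_cond_exp M (F k) u \<omega>"
    by (rule F.real_cond_exp_mono[OF _ _ iu]) (use ub ib in \<open>auto elim: eventually_mono\<close>)
  moreover have "AE \<omega> in M. real_cond_exp M (F k) b \<omega> = b \<omega>" by (rule F.real_cond_exp_F_meas[OF ib bF])
  moreover have "AE \<omega> in M. real_cond_exp M (F k) (\<lambda>\<omega>. - b \<omega>) \<omega> = - b \<omega>"
    by (rule F.real_cond_exp_F_meas) (use ib bF in auto)
  ultimately show ?thesis unfolding b_def[symmetric] by eventually_elim auto
qed

lemma drift_sq_integrable: "sq_integrable M (drift i j k)"
proof (rule sq_integrable_bound[OF g_sq_integrable[of k], where C = "\<alpha> k / h1"])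
  show "drift i j k \<in> borel_measurable M" by (simp add: drift_def borel_measurable_cond_exp2)
  show "AE \<omega> in M. norm (drift i j k \<omega>) \<le> \<alpha> k / h1 * norm (g k \<omega>)" using drift_bound by simp
qed

lemma mart_sq_integrable: "sq_integrable M (mart i j k)"
  unfolding mart_def by (intro sq_integrable_diff \<Delta>_sq_integrable drift_sq_integrable)

text \<open>With \<open>s = (\<alpha> k)\<^sup>2 / h1\<^sup>2\<close>, twice the squared increment
  contributes \<open>4 * s\<close> times each of the squared norms of gradient and noise; twice the
  squared drift adds \<open>2 * s\<close> for the gradient.\<close>

lemma mart_second_moment:
  "(\<integral>\<omega>. (mart i j k \<omega>)\<^sup>2 \<partial>M) \<le> 6 / h1\<^sup>2 * ((\<alpha> k)\<^sup>2 * (\<integral>\<omega>. (norm (g k \<omega>))\<^sup>2 \<partial>M)) + 4 / h1\<^sup>2 * ((\<alpha> k)\<^sup>2 * (\<sigma> k)\<^sup>2)"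
proof -
  let ?a = "\<alpha> k"
  have i1: "integrable M (\<lambda>\<omega>. (norm (g k \<omega>))\<^sup>2)" by (intro sq_integrable_square g_sq_integrable)
  have i2: "integrable M (\<lambda>\<omega>. (norm (X k \<omega>))\<^sup>2)" by (intro sq_integrable_square noise_sq_integrable)
  have pt: "AE \<omega> in M. (mart i j k \<omega>)\<^sup>2 \<le> 6 / h1\<^sup>2 * (?a\<^sup>2 * (norm (g k \<omega>))\<^sup>2) + 4 / h1\<^sup>2 * (?a\<^sup>2 * (norm (X k \<omega>))\<^sup>2)"
    using P_bounds[of k] drift_bound[of i j k] AE_space
  proof eventually_elim
    case (elim \<omega>)
    define s where "s = ?a\<^sup>2 / h1\<^sup>2"
    have s0: "0 \<le> s" by (simp add: s_def)
    have "\<bar>\<Delta> i j k \<omega>\<bar> \<le> norm (\<Theta> (Suc k) \<omega> - \<Theta> k \<omega>)" unfolding \<Delta>_def by (rule norm_matrix_nth_le)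
    also have "\<dots> = ?a * norm (P k \<omega> ** G k \<omega>)" using step[OF elim(3)] \<alpha>_pos[of k] by simp
    also have "\<dots> \<le> ?a * (norm (G k \<omega>) / h1)" using elim(1) \<alpha>_pos[of k] by (intro mult_left_mono) auto
    finally have "\<bar>\<Delta> i j k \<omega>\<bar>\<^sup>2 \<le> (?a * (norm (G k \<omega>) / h1))\<^sup>2" by (intro power_mono) auto
    then have 1: "(\<Delta> i j k \<omega>)\<^sup>2 \<le> s * (norm (G k \<omega>))\<^sup>2" by (simp add: s_def power_mult_distrib power_divide)
    have "(norm (G k \<omega>))\<^sup>2 \<le> 2 * (norm (g k \<omega>))\<^sup>2 + 2 * (norm (X k \<omega>))\<^sup>2" using norm_add_sq_le[of "g k \<omega>" "X k \<omega>"] by simp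
    then have 2: "s * (norm (G k \<omega>))\<^sup>2 \<le> s * (2 * (norm (g k \<omega>))\<^sup>2 + 2 * (norm (X k \<omega>))\<^sup>2)" using s0 by (rule mult_left_mono)
    have "\<bar>drift i j k \<omega>\<bar>\<^sup>2 \<le> (?a / h1 * norm (g k \<omega>))\<^sup>2" using elim(2) by (intro power_mono) auto
    then have 3: "(drift i j k \<omega>)\<^sup>2 \<le> s * (norm (g k \<omega>))\<^sup>2" by (simp add: s_def power_mult_distrib power_divide)
    have "(mart i j k \<omega>)\<^sup>2 \<le> 2 * (\<Delta> i j k \<omega>)\<^sup>2 + 2 * (drift i j k \<omega>)\<^sup>2"
      using norm_add_sq_le[of "\<Delta> i j k \<omega>" "- drift i j k \<omega>"] by (simp add: mart_def)
    then have "(mart i j k \<omega>)\<^sup>2 \<le> 6 * (s * (norm (g k \<omega>))\<^sup>2) + 4 * (s * (norm (X k \<omega>))\<^sup>2)"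
      using 1 2 3 by (simp add: distrib_left)
    then show ?case by (simp add: s_def)
  qed
  have "(\<integral>\<omega>. (mart i j k \<omega>)\<^sup>2 \<partial>M) \<le> (\<integral>\<omega>. 6 / h1\<^sup>2 * (?a\<^sup>2 * (norm (g k \<omega>))\<^sup>2) + 4 / h1\<^sup>2 * (?a\<^sup>2 * (norm (X k \<omega>))\<^sup>2) \<partial>M)"
    by (rule integral_mono_AE[OF _ _ pt])
      (use sq_integrable_square[OF mart_sq_integrable] i1 i2 in \<open>auto intro!: Bochner_Integration.integrable_add integrable_mult_right\<close>)
  also have "\<dots> = 6 / h1\<^sup>2 * (?a\<^sup>2 * (\<integral>\<omega>. (norm (g k \<omega>))\<^sup>2 \<partial>M)) + 4 / h1\<^sup>2 * (?a\<^sup>2 * (\<integral>\<omega>. (norm (X k \<omega>))\<^sup>2 \<partial>M))"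
    using i1 i2 by simp
  also have "\<dots> \<le> 6 / h1\<^sup>2 * (?a\<^sup>2 * (\<integral>\<omega>. (norm (g k \<omega>))\<^sup>2 \<partial>M)) + 4 / h1\<^sup>2 * (?a\<^sup>2 * (\<sigma> k)\<^sup>2)"
    by (intro add_left_mono mult_left_mono noise_second_moment) auto
  finally show ?thesis .
qed

lemma AE_summable_mart: "AE \<omega> in M. summable (\<lambda>k. mart i j k \<omega>)"
proof (rule summable_L2_martingale_differences[OF prob_space_axioms subalg sets_history_mono])
  fix k
  interpret F: finite_measure_subalgebra M "F k" by (rule finite_subalg)
  have dF: "drift i j k \<in> borel_measurable (F k)" by (simp add: drift_def)
  have "subalgebra (F (Suc k)) (F k)" by (simp add: subalgebra_def sets_history_mono)
  then have "drift i j k \<in> borel_measurable (F (Suc k))" using dF by (rule measurable_from_subalg)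
  then show "mart i j k \<in> borel_measurable (F (Suc k))"
    unfolding mart_def \<Delta>_def using measurable_history[of k "Suc k" \<Theta> M] measurable_history[of "Suc k" "Suc k" \<Theta> M]
    by measurable
  show "integrable M (\<lambda>\<omega>. (mart i j k \<omega>)\<^sup>2)"
    using sq_integrable_square[OF mart_sq_integrable, of i j k] by simp
  fix Y :: "'w \<Rightarrow> real" assume Y: "Y \<in> borel_measurable (F k)" "integrable M (\<lambda>\<omega>. (Y \<omega>)\<^sup>2)"
  have Y2: "sq_integrable M Y" using Y F_imp_M by (simp add: sq_integrable_def)
  have i: "integrable M (\<lambda>\<omega>. Y \<omega> * \<Delta> i j k \<omega>)"
    using integrable_inner_sq_integrable[OF Y2 \<Delta>_sq_integrable] by simp
  have "\<Delta> i j k \<in> borel_measurable M" using \<Delta>_integrable by simp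
  \<comment> \<open>The increment and its conditional expectation have the same integral against
    \<open>Y\<close>, a function of the past.\<close>
  from F.real_cond_exp_intg[OF i Y(1) this]
  show "(\<integral>\<omega>. Y \<omega> * mart i j k \<omega> \<partial>M) = 0"
    using i by (simp add: mart_def drift_def right_diff_distrib)
next
  \<comment> \<open>The uniform step size bound, which turns the factor
    \<open>(\<alpha> k)\<^sup>2\<close> of the gradient term into \<open>A * \<alpha> k\<close>,
    whose series is already known to converge.\<close>
  define A where "A = 2 * h1\<^sup>2 / (L * h2)"
  show "summable (\<lambda>k. \<integral>\<omega>. (mart i j k \<omega>)\<^sup>2 \<partial>M)"
  proof (rule summable_comparison_test, intro exI allI impI)
    fix k
    have "(\<alpha> k)\<^sup>2 * (\<integral>\<omega>. (norm (g k \<omega>))\<^sup>2 \<partial>M) \<le> A * (\<alpha> k * (\<integral>\<omega>. (norm (g k \<omega>))\<^sup>2 \<partial>M))"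
      using mult_right_mono[OF \<alpha>_le[of k], of "\<alpha> k * (\<integral>\<omega>. (norm (g k \<omega>))\<^sup>2 \<partial>M)"] \<alpha>_pos[of k]
      by (simp add: A_def power2_eq_square mult_ac)
    then have "6 / h1\<^sup>2 * ((\<alpha> k)\<^sup>2 * (\<integral>\<omega>. (norm (g k \<omega>))\<^sup>2 \<partial>M)) \<le> 6 / h1\<^sup>2 * (A * (\<alpha> k * (\<integral>\<omega>. (norm (g k \<omega>))\<^sup>2 \<partial>M)))"
      by (intro mult_left_mono) auto
    then show "norm (\<integral>\<omega>. (mart i j k \<omega>)\<^sup>2 \<partial>M)
      \<le> 6 / h1\<^sup>2 * (A * (\<alpha> k * (\<integral>\<omega>. (norm (g k \<omega>))\<^sup>2 \<partial>M))) + 4 / h1\<^sup>2 * ((\<alpha> k)\<^sup>2 * (\<sigma> k)\<^sup>2)"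
      using mart_second_moment[of i j k] by simp
  next
    show "summable (\<lambda>k. 6 / h1\<^sup>2 * (A * (\<alpha> k * (\<integral>\<omega>. (norm (g k \<omega>))\<^sup>2 \<partial>M))) + 4 / h1\<^sup>2 * ((\<alpha> k)\<^sup>2 * (\<sigma> k)\<^sup>2))"
      by (intro summable_add summable_mult summable_expected_gradient noise)
  qed
qed auto

text \<open>\<open>gradient_limit_zero\<close> applied path by path; the exceptional sets are
  indexed by entries and iterations, so their union is null.\<close>

theorem AE_gradient_tendsto_0: "AE \<omega> in M. (\<lambda>k. norm (g k \<omega>)) \<longlonglongrightarrow> 0"
proof -
  have "AE \<omega> in M. \<forall>i j k. \<bar>drift i j k \<omega>\<bar> \<le> \<alpha> k / h1 * norm (g k \<omega>)"
    using drift_bound by (simp add: AE_all_countable)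
  moreover have "AE \<omega> in M. \<forall>i j. summable (\<lambda>k. mart i j k \<omega>)"
    using AE_summable_mart by (simp add: AE_all_countable)
  ultimately show ?thesis using AE_summable_gradient
  proof eventually_elim
    case (elim \<omega>)
    define d :: "nat \<Rightarrow> real ^ 'n ^ 'm" where "d k = (\<chi> i j. drift i j k \<omega>)" for k
    define e :: "nat \<Rightarrow> real ^ 'n ^ 'm" where "e k = (\<chi> i j. mart i j k \<omega>)" for k
    \<comment> \<open>The Frobenius norm is at most the sum of the absolute entries, and each of
      these has the drift bound with factor \<open>1 / h1\<close>.\<close>
    define C where "C = real CARD('m) * real CARD('n) / h1"
    show ?case
    proof (rule gradient_limit_zero[where x = "\<lambda>k. \<Theta> k \<omega>" and d = d and e = e])
      show "norm (g i \<omega>) - norm (g j \<omega>) \<le> L * norm (\<Theta> i \<omega> - \<Theta> j \<omega>)" for i j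
        using norm_triangle_ineq2[of "g i \<omega>" "g j \<omega>"] lipschitz order_trans by blast
      show "\<Theta> (Suc k) \<omega> = \<Theta> k \<omega> + (d k + e k)" for k
        by (simp add: vec_eq_iff d_def e_def mart_def \<Delta>_def)
      show "norm (d k) \<le> C * (\<alpha> k * norm (g k \<omega>))" for k
      proof -
        have "norm (d k) \<le> (\<Sum>i\<in>(UNIV :: 'm set). \<Sum>j\<in>(UNIV :: 'n set). \<bar>drift i j k \<omega>\<bar>)"
          using norm_matrix_le_sum[of "d k"] by (simp add: d_def)
        also have "\<dots> \<le> (\<Sum>i\<in>(UNIV :: 'm set). \<Sum>j\<in>(UNIV :: 'n set). \<alpha> k / h1 * norm (g k \<omega>))"
          using elim(1) by (intro sum_mono) auto
        also have "\<dots> = C * (\<alpha> k * norm (g k \<omega>))" by (simp add: C_def)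
        finally show ?thesis .
      qed
      show "summable e" using elim(2) by (intro summable_matrix) (simp add: e_def)
      show "0 < C" using h1_pos by (simp add: C_def)
      show "0 \<le> \<alpha> k" for k using \<alpha>_pos[of k] by simp
    qed (use L_pos elim(3) \<alpha>_le \<alpha>_div in auto)
  qed
qed

end

section \<open>The method NG+\<close>

lemma borel_measurable_minibatch_grad:
  assumes "\<And>i \<theta>. i \<in> A \<Longrightarrow> psi i differentiable (at \<theta>)"
  shows "minibatch_grad psi A \<in> borel_measurable borel"
proof -
  have [measurable]: "grad (psi i) \<in> borel_measurable borel" if "i \<in> A" for i
    using borel_measurable_grad[of "psi i"] assms[OF that] by blast
  show ?thesis unfolding minibatch_grad_def by measurable
qed

lemma borel_measurable_curvature:
  assumes "\<And>i \<theta>. i \<in> A \<Longrightarrow> psi i differentiable (at \<theta>)"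
  shows "curvature psi A \<in> borel_measurable borel"
proof -
  have [measurable]: "grad (psi i) \<in> borel_measurable borel" if "i \<in> A" for i
    using borel_measurable_grad[of "psi i"] assms[OF that] by blast
  show ?thesis unfolding curvature_def by measurable
qed

text \<open>The random sample sets take only finitely many values; for each fixed value the
  gradients and curvature are Borel functions of the iterate, and these pieces are glued together.
  The rest is induction along the recursion.\<close>

lemma ng_plus_measurable:
  fixes psi :: "nat \<Rightarrow> real ^ 'n ^ 'm \<Rightarrow> real"
  assumes psi_diff: "\<And>i \<theta>. i \<in> {1..N} \<Longrightarrow> psi i differentiable (at \<theta>)"
    and B_meas: "\<And>k. B k \<in> measurable M (count_space (Pow {1..N} - {{}}))"
    and S_meas: "\<And>k. k mod T = 0 \<Longrightarrow> S k \<in> measurable M (count_space (Pow {1..N} - {{}}))"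
    and l_meas[measurable]: "\<And>k. l k \<in> borel_measurable M"
    and run: "\<And>\<omega>. \<omega> \<in> space M \<Longrightarrow>
        ng_plus psi T \<Theta>0 \<alpha> (\<lambda>k. l k \<omega>) (\<lambda>k. B k \<omega>) (\<lambda>k. S k \<omega>)
          (\<lambda>k. G k \<omega>) (\<lambda>k. L k \<omega>) (\<lambda>k. \<Theta> k \<omega>)"
  shows "\<Theta> k \<in> borel_measurable M \<and> G k \<in> borel_measurable M \<and> L k \<in> borel_measurable M"
proof -
  have fin: "countable (Pow {1..N} - {{}})" by (intro countable_finite) simp
  have G: "G k \<in> borel_measurable M" if [measurable]: "\<Theta> k \<in> borel_measurable M" for k
  proof -
    have "(\<lambda>\<omega>. minibatch_grad psi (B k \<omega>) (\<Theta> k \<omega>)) \<in> borel_measurable M"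
    proof (rule measurable_compose_countable'[OF _ B_meas fin])
      fix A assume "A \<in> Pow {1..N} - {{}}"
      then have [measurable]: "minibatch_grad psi A \<in> borel_measurable borel"
        by (intro borel_measurable_minibatch_grad psi_diff) auto
      show "(\<lambda>\<omega>. minibatch_grad psi A (\<Theta> k \<omega>)) \<in> borel_measurable M" by measurable
    qed
    moreover have "minibatch_grad psi (B k \<omega>) (\<Theta> k \<omega>) = G k \<omega>" if "\<omega> \<in> space M" for \<omega>
      using run[OF that] by (simp add: ng_plus_def)
    ultimately show ?thesis by (simp cong: measurable_cong)
  qed
  \<comment> \<open>The demand on \<open>L (k - 1)\<close> is guarded by
    \<open>k mod T \<noteq> 0\<close>, which is false at \<open>k = 0\<close>, so the base case
    needs no predecessor.\<close>
  have L: "L k \<in> borel_measurable M"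
    if [measurable]: "\<Theta> k \<in> borel_measurable M" and prev: "k mod T \<noteq> 0 \<Longrightarrow> L (k - 1) \<in> borel_measurable M" for k
  proof (cases "k mod T = 0")
    case True
    have "(\<lambda>\<omega>. curvature psi (S k \<omega>) (\<Theta> k \<omega>)) \<in> borel_measurable M"
    proof (rule measurable_compose_countable'[OF _ S_meas[OF True] fin])
      fix A assume "A \<in> Pow {1..N} - {{}}"
      then have [measurable]: "curvature psi A \<in> borel_measurable borel"
        by (intro borel_measurable_curvature psi_diff) auto
      show "(\<lambda>\<omega>. curvature psi A (\<Theta> k \<omega>)) \<in> borel_measurable M" by measurable
    qed
    moreover have "curvature psi (S k \<omega>) (\<Theta> k \<omega>) = L k \<omega>" if "\<omega> \<in> space M" for \<omega>
      using run[OF that] True by (simp add: ng_plus_def)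
    ultimately show ?thesis by (simp cong: measurable_cong)
  next
    case False
    have "L (k - 1) \<omega> = L k \<omega>" if "\<omega> \<in> space M" for \<omega>
      using run[OF that] False unfolding ng_plus_def by metis
    with prev[OF False] show ?thesis by (simp cong: measurable_cong)
  qed
  show ?thesis
  proof (induction k)
    case 0
    have "\<Theta>0 = \<Theta> 0 \<omega>" if "\<omega> \<in> space M" for \<omega> using run[OF that] by (simp add: ng_plus_def)
    with measurable_const[of \<Theta>0 borel M] have "\<Theta> 0 \<in> borel_measurable M" by (simp cong: measurable_cong)
    then show ?case using G L[of 0] by simp
  next
    case (Suc k)
    then have [measurable]: "\<Theta> k \<in> borel_measurable M" "G k \<in> borel_measurable M" "L k \<in> borel_measurable M"
      by auto
    have "(\<lambda>\<omega>. \<Theta> k \<omega> + \<alpha> k *\<^sub>R (- (matrix_inv (damped (l k \<omega>) (L k \<omega>)) ** G k \<omega>))) \<in> borel_measurable M"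
      unfolding damped_def by measurable
    moreover have "\<Theta> k \<omega> + \<alpha> k *\<^sub>R (- (matrix_inv (damped (l k \<omega>) (L k \<omega>)) ** G k \<omega>)) = \<Theta> (Suc k) \<omega>"
      if "\<omega> \<in> space M" for \<omega>
      using run[OF that] by (simp add: ng_plus_def)
    ultimately have "\<Theta> (Suc k) \<in> borel_measurable M" by (simp cong: measurable_cong)
    then show ?case using G L[of "Suc k"] Suc by simp
  qed
qed

theorem theorem2:
  fixes M :: "'w measure"
    and psi :: "nat \<Rightarrow> real ^ 'n ^ 'm \<Rightarrow> real"
    and N T :: nat
    and \<Theta>0 :: "real ^ 'n ^ 'm"
    and \<alpha> \<sigma> :: "nat \<Rightarrow> real"
    and l :: "nat \<Rightarrow> 'w \<Rightarrow> real"
    and B S :: "nat \<Rightarrow> 'w \<Rightarrow> nat set"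
    and G \<Theta> :: "nat \<Rightarrow> 'w \<Rightarrow> real ^ 'n ^ 'm"
    and L :: "nat \<Rightarrow> 'w \<Rightarrow> real ^ 'm ^ 'm"
    and \<Psi>min L\<Psi> h1 h2 :: real
  assumes dims: "CARD('m) \<le> CARD('n)"
    and N: "1 \<le> N"
    and T: "1 \<le> T"
    and prob: "prob_space M"
    \<comment> \<open>the individual losses have gradients\<close>
    and psi_diff: "\<And>i \<theta>. i \<in> {1..N} \<Longrightarrow> psi i differentiable (at \<theta>)"
    \<comment> \<open>random nonempty sample sets and random damping values\<close>
    and B_meas: "\<And>k. B k \<in> measurable M (count_space (Pow {1..N} - {{}}))"
    and S_meas: "\<And>k. k mod T = 0 \<Longrightarrow> S k \<in> measurable M (count_space (Pow {1..N} - {{}}))"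
    and l_meas: "\<And>k. l k \<in> borel_measurable M"
    \<comment> \<open>the iteration\<close>
    and step_pos: "\<And>k. 0 < \<alpha> k"
    and run: "\<And>\<omega>. \<omega> \<in> space M \<Longrightarrow>
        ng_plus psi T \<Theta>0 \<alpha> (\<lambda>k. l k \<omega>) (\<lambda>k. B k \<omega>) (\<lambda>k. S k \<omega>)
          (\<lambda>k. G k \<omega>) (\<lambda>k. L k \<omega>) (\<lambda>k. \<Theta> k \<omega>)"
    \<comment> \<open>given the past iterates, the mini-batch gradient is independent of the preconditioner\<close>
    and sampling_indep: "\<And>k. cond_indep_var M (history M \<Theta> k) (\<lambda>\<omega>. damped (l k \<omega>) (L k \<omega>)) (G k)"
    \<comment> \<open>the objective\<close>
    and obj_diff: "\<And>\<theta>. objective N psi differentiable (at \<theta>)"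
    and obj_C1: "continuous_on UNIV (grad (objective N psi))"
    and obj_bound: "\<And>\<theta>. \<Psi>min \<le> objective N psi \<theta>"
    and L\<Psi>_pos: "0 < L\<Psi>"
    and obj_lipschitz: "\<And>\<theta>1 \<theta>2. norm (grad (objective N psi) \<theta>1 - grad (objective N psi) \<theta>2)
                           \<le> L\<Psi> * norm (\<theta>1 - \<theta>2)"
    \<comment> \<open>uniform bounds on the preconditioner\<close>
    and h1_pos: "0 < h1"
    and h1_h2: "h1 < h2"
    and spectrum: "\<And>k. AE \<omega> in M. h1 *\<^sub>R mat 1 \<preceq>\<^sub>L damped (l k \<omega>) (L k \<omega>)
                                 \<and> damped (l k \<omega>) (L k \<omega>) \<preceq>\<^sub>L h2 *\<^sub>R mat 1"
    \<comment> \<open>unbiased mini-batch gradients with bounded conditional variance\<close>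
    and unbiased: "\<And>k. AE \<omega> in M.
        mat_cond_exp M (history M \<Theta> k) (G k) \<omega> = grad (objective N psi) (\<Theta> k \<omega>)"
    and variance: "\<And>k. AE \<omega> in M.
        nn_cond_exp M (history M \<Theta> k)
          (\<lambda>\<omega>'. ennreal ((norm (G k \<omega>' - grad (objective N psi) (\<Theta> k \<omega>')))\<^sup>2)) \<omega>
        \<le> ennreal ((\<sigma> k)\<^sup>2)"
    \<comment> \<open>step sizes\<close>
    and step_bound: "\<And>k. \<alpha> k \<le> 2 * h1\<^sup>2 / (L\<Psi> * h2)"
    and step_div: "filterlim (\<lambda>K. \<Sum>k<K. \<alpha> k) at_top sequentially"
    and step_noise: "summable (\<lambda>k. (\<alpha> k)\<^sup>2 * (\<sigma> k)\<^sup>2)"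
  shows "AE \<omega> in M. (\<lambda>k. norm (grad (objective N psi) (\<Theta> k \<omega>))) \<longlonglongrightarrow> 0"
proof -
  note meas = ng_plus_measurable[OF psi_diff B_meas S_meas l_meas run]
  have "\<not> summable \<alpha>"
  proof
    assume "summable \<alpha>"
    then have "(\<lambda>K. \<Sum>k<K. \<alpha> k) \<longlonglongrightarrow> suminf \<alpha>" by (rule summable_LIMSEQ)
    moreover have "filterlim (\<lambda>K. \<Sum>k<K. \<alpha> k) at_infinity sequentially"
      using step_div by (rule filterlim_at_top_imp_at_infinity)
    ultimately show False using not_tendsto_and_filterlim_at_infinity[OF sequentially_bot] by blast
  qed
  moreover have "(\<lambda>\<omega>. damped (l k \<omega>) (L k \<omega>)) \<in> borel_measurable M" for k
  proof -
    have [measurable]: "L k \<in> borel_measurable M" using meas[of k] by simp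
    note [measurable] = l_meas[of k]
    show ?thesis unfolding damped_def by measurable
  qed
  moreover have "\<Theta> 0 \<omega> = \<Theta>0" if "\<omega> \<in> space M" for \<omega>
    using run[OF that] by (simp add: ng_plus_def)
  moreover have "\<Theta> (Suc k) \<omega> = \<Theta> k \<omega> - \<alpha> k *\<^sub>R (matrix_inv (damped (l k \<omega>) (L k \<omega>)) ** G k \<omega>)"
    if "\<omega> \<in> space M" for k \<omega>
    using run[OF that] by (simp add: ng_plus_def)
  \<comment> \<open>The damped curvature matrix takes the role of \<open>H\<close>; conditional
    independence and the spectral bounds are assumed for exactly this matrix.\<close>
  ultimately interpret preconditioned_sgd M "objective N psi" "grad (objective N psi)" \<Theta>0 \<Theta> G
      "\<lambda>k \<omega>. damped (l k \<omega>) (L k \<omega>)" \<alpha> \<sigma> \<Psi>min L\<Psi> h1 h2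
    by (intro preconditioned_sgd.intro preconditioned_sgd_axioms.intro prob sampling_indep
        GDERIV_grad[OF obj_diff] obj_bound L\<Psi>_pos obj_lipschitz h1_pos h1_h2 spectrum unbiased variance
        step_pos step_bound step_noise meas[THEN conjunct1] meas[THEN conjunct2, THEN conjunct1])
  show ?thesis by (rule AE_gradient_tendsto_0)
qed


end
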